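(* Let $\pi:(M,\varphi,\xi,\eta,g)\to(M',J,g')$ be a contact-complex Riemannian submersion with $\dim M=2m+1\ge 5$ and $\dim M'=2n\geq 2$. Let $\omega$ be the Lee form of $M$ and $B=\omega^\sharp$ the Lee vector field, and assume that $d\phi=-2\omega\wedge\phi$. Then: (1) $\delta\eta=0$; (2) the O'Neill invariant $A$ of $\pi$ satisfies, for all horizontal vector fields $X,Y\in\chi^h(M)$ and every vertical vector field $U\in\chi^v(M)$, \[A_XU=\eta(U)A_X\xi-\omega(\varphi U)\varphi X,\] \[A_XY=\eta(A_XY)\xi+\phi(X,Y)\,v(\varphi B),\] \[A_{\varphi X}U-\varphi(A_XU)=\eta(U)\big(A_{\varphi X}\xi-\varphi(A_X\xi)\big),\] \[A_XY-A_{\varphi X}\varphi Y=\eta\big(A_XY-A_{\varphi X}\varphi Y\big)\xi.\]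
   Context: All objects are smooth. An almost contact metric (ACM) manifold $(M,\varphi,\xi,\eta,g)$ is a $(2m+1)$-dimensional Riemannian manifold with a $(1,1)$-tensor field $\varphi$, a vector field $\xi$ and a 1-form $\eta$ such that $\varphi^2=-I+\eta\otimes\xi$, $\eta(\xi)=1$, $g(\varphi X,\varphi Y)=g(X,Y)-\eta(X)\eta(Y)$. Its fundamental form is the 2-form $\phi(X,Y)=g(X,\varphi Y)$. $\nabla$ is the Levi-Civita connection and $\delta$ the codifferential: for a local orthonormal frame $\{e_i\}$, $\delta\eta=-\sum_i(\nabla_{e_i}\eta)(e_i)$ and $\delta\phi(X)=-\sum_i(\nabla_{e_i}\phi)(e_i,X)$. For $m\ge2$ the Lee form of $M$ is \[\omega=-\tfrac{1}{2(m-1)}\big(\delta\phi\circ\varphi+\nabla_\xi\eta\big)+\tfrac{\delta\eta}{2m}\,\eta .\] The Lee vector field is $B=\omega^\sharp$ (the $g$-dual of $\omega$). An almost Hermitian manifold $(M',J,g')$ has $J^2=-I$ and $g'(JX,JY)=g'(X,Y)$. A contact-complex Riemannian submersion $\pi:(M,\varphi,\xi,\eta,g)\to(M',J,g')$ is a Riemannian submersion from an ACM manifold onto an almost Hermitian manifold with $J\circ\pi_*=\pi_*\circ\varphi$. Let $\mathcal V=\ker\pi_*$ be the vertical distribution, $\mathcal H=\mathcal V^\perp$ the horizontal one, $v,h$ the orthogonal projections on $\mathcal V,\mathcal H$, and $\chi^v(M),\chi^h(M)$ the vertical and horizontal vector fields. ($\xi$ is vertical and $\varphi$ preserves $\mathcal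 V$ and $\mathcal H$.) The O'Neill invariant $A$ is $A_EF=v(\nabla_{hE}hF)+h(\nabla_{hE}vF)$ for vector fields $E,F$ on $M$. *)

theory Defs
  imports "HOL-Analysis.Analysis"
begin

section \<open>Smooth functions on open subsets of Euclidean space\<close>

primrec Ck_on :: "nat \<Rightarrow> 'e::euclidean_space set \<Rightarrow> ('e \<Rightarrow> 'b::real_normed_vector) \<Rightarrow> bool" where
  "Ck_on 0 S f \<longleftrightarrow> continuous_on S f"
| "Ck_on (Suc k) S f \<longleftrightarrow> (\<forall>x\<in>S. f differentiable (at x)) \<and>
     (\<forall>v. Ck_on k S (\<lambda>x. frechet_derivative f (at x) v))"

definition smooth_on :: "'e::euclidean_space set \<Rightarrow> ('e \<Rightarrow> 'b::real_normed_vector) \<Rightarrow> bool" where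
  "smooth_on S f \<longleftrightarrow> (\<forall>k. Ck_on k S f)"


section \<open>Smooth manifolds, tangent vectors and vector fields\<close>

text \<open>The underlying topological space of a manifold is a whole type of class
  \<^class>\<open>t2_space\<close> and \<^class>\<open>second_countable_topology\<close>.  A chart is a domain together with
  a coordinate map to the model space; the coordinate map is meaningful on the domain only.\<close>

type_synonym ('a, 'e) chart = "'a set \<times> ('a \<Rightarrow> 'e)"

abbreviation cdom :: "('a, 'e) chart \<Rightarrow> 'a set" where "cdom \<equiv> fst"
abbreviation cmap :: "('a, 'e) chart \<Rightarrow> 'a \<Rightarrow> 'e" where "cmap \<equiv> snd"

definition cinv :: "('a, 'e) chart \<Rightarrow> 'e \<Rightarrow> 'a" where
  "cinv c = inv_into (cdom c) (cmap c)"

definition smooth_manifold ::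
  "('a::{t2_space, second_countable_topology}, 'e::euclidean_space) chart set \<Rightarrow> bool" where
  "smooth_manifold A \<longleftrightarrow>
     (\<Union>c\<in>A. cdom c) = UNIV \<and>
     (\<forall>c\<in>A. open (cdom c) \<and> open (cmap c ` cdom c) \<and>
        homeomorphism (cdom c) (cmap c ` cdom c) (cmap c) (cinv c)) \<and>
     (\<forall>c\<in>A. \<forall>d\<in>A. smooth_on (cmap c ` (cdom c \<inter> cdom d)) (cmap d \<circ> cinv c))"

text \<open>Every point gets a preferred chart, and the tangent space at \<open>p\<close> is the model space
  \<open>'e\<close>, a vector being given by its components in the preferred chart at \<open>p\<close>.
  As the preferred chart jumps from point to point, smoothness of a vector field is always
  tested on its components with respect to a fixed chart.\<close>

definition chart_at :: "('a, 'e) chart set \<Rightarrow> 'a \<Rightarrow> ('a, 'e) chart" where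
  "chart_at A p = (SOME c. c \<in> A \<and> p \<in> cdom c)"

definition components ::
  "('a, 'e::euclidean_space) chart set \<Rightarrow> ('a, 'e) chart \<Rightarrow> 'a \<Rightarrow> 'e \<Rightarrow> 'e" where
  "components A c p v =
     frechet_derivative (cmap c \<circ> cinv (chart_at A p)) (at (cmap (chart_at A p) p)) v"

definition local_rep ::
  "('a, 'e::euclidean_space) chart set \<Rightarrow> ('a, 'e) chart \<Rightarrow> ('a \<Rightarrow> 'e) \<Rightarrow> 'e \<Rightarrow> 'e" where
  "local_rep A c X z = components A c (cinv c z) (X (cinv c z))"

definition smooth_fun ::
  "('a, 'e::euclidean_space) chart set \<Rightarrow> 'a set \<Rightarrow> ('a \<Rightarrow> real) \<Rightarrow> bool" where
  "smooth_fun A W f \<longleftrightarrow> (\<forall>c\<in>A. smooth_on (cmap c ` (cdom c \<inter> W)) (f \<circ> cinv c))"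

text \<open>\<open>vector_field A W X\<close>: \<open>X\<close> is a smooth vector field on the open set \<open>W\<close>
  (the values of \<open>X\<close> outside \<open>W\<close> are irrelevant).\<close>

definition vector_field ::
  "('a, 'e::euclidean_space) chart set \<Rightarrow> 'a set \<Rightarrow> ('a \<Rightarrow> 'e) \<Rightarrow> bool" where
  "vector_field A W X \<longleftrightarrow> (\<forall>c\<in>A. smooth_on (cmap c ` (cdom c \<inter> W)) (local_rep A c X))"

definition dir_deriv ::
  "('a, 'e::euclidean_space) chart set \<Rightarrow> ('a \<Rightarrow> 'e) \<Rightarrow> ('a \<Rightarrow> real) \<Rightarrow> 'a \<Rightarrow> real" where
  "dir_deriv A X f p =
     frechet_derivative (f \<circ> cinv (chart_at A p)) (at (cmap (chart_at A p) p)) (X p)"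

text \<open>The Lie bracket, \<open>[X, Y] = DY(X) - DX(Y)\<close> in the preferred chart at the given point.\<close>

definition lie_bracket ::
  "('a, 'e::euclidean_space) chart set \<Rightarrow> ('a \<Rightarrow> 'e) \<Rightarrow> ('a \<Rightarrow> 'e) \<Rightarrow> 'a \<Rightarrow> 'e" where
  "lie_bracket A X Y p =
     frechet_derivative (local_rep A (chart_at A p) Y) (at (cmap (chart_at A p) p)) (X p) -
     frechet_derivative (local_rep A (chart_at A p) X) (at (cmap (chart_at A p) p)) (Y p)"

definition smooth_map ::
  "('a::topological_space, 'e::euclidean_space) chart set \<Rightarrow>
   ('b::topological_space, 'f::euclidean_space) chart set \<Rightarrow> ('a \<Rightarrow> 'b) \<Rightarrow> bool" where
  "smooth_map A A' f \<longleftrightarrow> continuous_on UNIV f \<and>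
     (\<forall>c\<in>A. \<forall>d\<in>A'. smooth_on (cmap c ` (cdom c \<inter> f -` cdom d)) (cmap d \<circ> f \<circ> cinv c))"

definition push ::
  "('a, 'e::euclidean_space) chart set \<Rightarrow> ('b, 'f::euclidean_space) chart set \<Rightarrow>
   ('a \<Rightarrow> 'b) \<Rightarrow> 'a \<Rightarrow> 'e \<Rightarrow> 'f" where
  "push A A' f p v = frechet_derivative (cmap (chart_at A' (f p)) \<circ> f \<circ> cinv (chart_at A p))
     (at (cmap (chart_at A p) p)) v"


section \<open>Tensor fields and the Levi-Civita connection\<close>

definition one_form ::
  "('a::topological_space, 'e::euclidean_space) chart set \<Rightarrow> ('a \<Rightarrow> 'e \<Rightarrow> real) \<Rightarrow> bool" where
  "one_form A \<alpha> \<longleftrightarrow> (\<forall>p. linear (\<alpha> p)) \<and>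
     (\<forall>W X. open W \<and> vector_field A W X \<longrightarrow> smooth_fun A W (\<lambda>p. \<alpha> p (X p)))"

definition tensor11 ::
  "('a::topological_space, 'e::euclidean_space) chart set \<Rightarrow> ('a \<Rightarrow> 'e \<Rightarrow> 'e) \<Rightarrow> bool" where
  "tensor11 A F \<longleftrightarrow> (\<forall>p. linear (F p)) \<and>
     (\<forall>W X. open W \<and> vector_field A W X \<longrightarrow> vector_field A W (\<lambda>p. F p (X p)))"

definition riemannian_metric ::
  "('a::topological_space, 'e::euclidean_space) chart set \<Rightarrow> ('a \<Rightarrow> 'e \<Rightarrow> 'e \<Rightarrow> real) \<Rightarrow> bool" where
  "riemannian_metric A g \<longleftrightarrow>
     (\<forall>p. bilinear (g p)) \<and>
     (\<forall>p u v. g p u v = g p v u) \<and>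
     (\<forall>p u. u \<noteq> 0 \<longrightarrow> g p u u > 0) \<and>
     (\<forall>W X Y. open W \<and> vector_field A W X \<and> vector_field A W Y \<longrightarrow>
        smooth_fun A W (\<lambda>p. g p (X p) (Y p)))"

text \<open>The Levi-Civita connection, acting on smooth vector fields defined on arbitrary open sets
  (so that it can be applied to local frames).  For vector fields that are smooth near a point,
  its value at the point is determined uniquely by these conditions.\<close>

definition levi_civita ::
  "('a::topological_space, 'e::euclidean_space) chart set \<Rightarrow> ('a \<Rightarrow> 'e \<Rightarrow> 'e \<Rightarrow> real) \<Rightarrow>
   (('a \<Rightarrow> 'e) \<Rightarrow> ('a \<Rightarrow> 'e) \<Rightarrow> 'a \<Rightarrow> 'e) \<Rightarrow> bool" where
  "levi_civita A g D \<longleftrightarrow>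
     (\<forall>W X Y Z f. open W \<and> vector_field A W X \<and> vector_field A W Y \<and> vector_field A W Z \<and>
        smooth_fun A W f \<longrightarrow>
        vector_field A W (D X Y) \<and>
        (\<forall>p\<in>W.
          D (\<lambda>q. X q + Y q) Z p = D X Z p + D Y Z p \<and>
          D (\<lambda>q. f q *\<^sub>R X q) Y p = f p *\<^sub>R D X Y p \<and>
          D X (\<lambda>q. Y q + Z q) p = D X Y p + D X Z p \<and>
          D X (\<lambda>q. f q *\<^sub>R Y q) p = dir_deriv A X f p *\<^sub>R Y p + f p *\<^sub>R D X Y p \<and>
          D X Y p - D Y X p = lie_bracket A X Y p \<and>
          dir_deriv A X (\<lambda>q. g q (Y q) (Z q)) p = g p (D X Y p) (Z p) + g p (Y p) (D X Z p)))"

text \<open>\<open>(\<nabla>\<^bsub>X\<^esub> \<alpha>)(Y)\<close> for a 1-form and \<open>(\<nabla>\<^bsub>X\<^esub> \<beta>)(Y, Z)\<close> for a 2-form.\<close>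

definition cov_deriv1 ::
  "('a, 'e::euclidean_space) chart set \<Rightarrow> (('a \<Rightarrow> 'e) \<Rightarrow> ('a \<Rightarrow> 'e) \<Rightarrow> 'a \<Rightarrow> 'e) \<Rightarrow>
   ('a \<Rightarrow> 'e \<Rightarrow> real) \<Rightarrow> ('a \<Rightarrow> 'e) \<Rightarrow> ('a \<Rightarrow> 'e) \<Rightarrow> 'a \<Rightarrow> real" where
  "cov_deriv1 A D \<alpha> X Y p = dir_deriv A X (\<lambda>q. \<alpha> q (Y q)) p - \<alpha> p (D X Y p)"

definition cov_deriv2 ::
  "('a, 'e::euclidean_space) chart set \<Rightarrow> (('a \<Rightarrow> 'e) \<Rightarrow> ('a \<Rightarrow> 'e) \<Rightarrow> 'a \<Rightarrow> 'e) \<Rightarrow>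
   ('a \<Rightarrow> 'e \<Rightarrow> 'e \<Rightarrow> real) \<Rightarrow> ('a \<Rightarrow> 'e) \<Rightarrow> ('a \<Rightarrow> 'e) \<Rightarrow> ('a \<Rightarrow> 'e) \<Rightarrow> 'a \<Rightarrow> real" where
  "cov_deriv2 A D \<beta> X Y Z p =
     dir_deriv A X (\<lambda>q. \<beta> q (Y q) (Z q)) p - \<beta> p (D X Y p) (Z p) - \<beta> p (Y p) (D X Z p)"

text \<open>Local orthonormal frames, indexed by the standard basis of the model space.\<close>

definition orthonormal_frame ::
  "('a, 'e::euclidean_space) chart set \<Rightarrow> ('a \<Rightarrow> 'e \<Rightarrow> 'e \<Rightarrow> real) \<Rightarrow> 'a set \<Rightarrow>
   ('e \<Rightarrow> 'a \<Rightarrow> 'e) \<Rightarrow> bool" where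
  "orthonormal_frame A g W E \<longleftrightarrow>
     (\<forall>b\<in>Basis. vector_field A W (E b)) \<and>
     (\<forall>p\<in>W. \<forall>b\<in>Basis. \<forall>b'\<in>Basis. g p (E b p) (E b' p) = (if b = b' then 1 else 0))"

text \<open>The codifferentials do not depend on the frame, so an arbitrary one around \<open>p\<close> is chosen.\<close>

definition frame_at ::
  "('a::topological_space, 'e::euclidean_space) chart set \<Rightarrow> ('a \<Rightarrow> 'e \<Rightarrow> 'e \<Rightarrow> real) \<Rightarrow> 'a \<Rightarrow>
   'e \<Rightarrow> 'a \<Rightarrow> 'e" where
  "frame_at A g p = (SOME E. \<exists>W. open W \<and> p \<in> W \<and> orthonormal_frame A g W E)"

definition codiff1 ::
  "('a::topological_space, 'e::euclidean_space) chart set \<Rightarrow> ('a \<Rightarrow> 'e \<Rightarrow> 'e \<Rightarrow> real) \<Rightarrow>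
   (('a \<Rightarrow> 'e) \<Rightarrow> ('a \<Rightarrow> 'e) \<Rightarrow> 'a \<Rightarrow> 'e) \<Rightarrow> ('a \<Rightarrow> 'e \<Rightarrow> real) \<Rightarrow> 'a \<Rightarrow> real" where
  "codiff1 A g D \<alpha> p =
     - (\<Sum>b\<in>Basis. cov_deriv1 A D \<alpha> (frame_at A g p b) (frame_at A g p b) p)"

definition codiff2 ::
  "('a::topological_space, 'e::euclidean_space) chart set \<Rightarrow> ('a \<Rightarrow> 'e \<Rightarrow> 'e \<Rightarrow> real) \<Rightarrow>
   (('a \<Rightarrow> 'e) \<Rightarrow> ('a \<Rightarrow> 'e) \<Rightarrow> 'a \<Rightarrow> 'e) \<Rightarrow> ('a \<Rightarrow> 'e \<Rightarrow> 'e \<Rightarrow> real) \<Rightarrow> ('a \<Rightarrow> 'e) \<Rightarrow> 'a \<Rightarrow> real" where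
  "codiff2 A g D \<beta> X p =
     - (\<Sum>b\<in>Basis. cov_deriv2 A D \<beta> (frame_at A g p b) (frame_at A g p b) X p)"

text \<open>Exterior derivative of a 2-form and wedge product of a 1-form with a 2-form, both evaluated
  on vector fields and both normalised without the factor \<open>1/3\<close>.  (With that factor in both,
  \<open>d\<beta>\<close> and \<open>\<omega> \<and> \<beta>\<close> are scaled alike, so linear relations between them are unaffected.)
  The 1-form \<open>\<omega>\<close> is given as an operator on vector fields, as is the Lee form below.\<close>

definition ext_deriv2 ::
  "('a, 'e::euclidean_space) chart set \<Rightarrow> ('a \<Rightarrow> 'e \<Rightarrow> 'e \<Rightarrow> real) \<Rightarrow>
   ('a \<Rightarrow> 'e) \<Rightarrow> ('a \<Rightarrow> 'e) \<Rightarrow> ('a \<Rightarrow> 'e) \<Rightarrow> 'a \<Rightarrow> real" where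
  "ext_deriv2 A \<beta> X Y Z p =
     dir_deriv A X (\<lambda>q. \<beta> q (Y q) (Z q)) p
   - dir_deriv A Y (\<lambda>q. \<beta> q (X q) (Z q)) p
   + dir_deriv A Z (\<lambda>q. \<beta> q (X q) (Y q)) p
   - \<beta> p (lie_bracket A X Y p) (Z p)
   + \<beta> p (lie_bracket A X Z p) (Y p)
   - \<beta> p (lie_bracket A Y Z p) (X p)"

definition wedge12 ::
  "(('a \<Rightarrow> 'e) \<Rightarrow> 'a \<Rightarrow> real) \<Rightarrow> ('a \<Rightarrow> 'e \<Rightarrow> 'e \<Rightarrow> real) \<Rightarrow>
   ('a \<Rightarrow> 'e) \<Rightarrow> ('a \<Rightarrow> 'e) \<Rightarrow> ('a \<Rightarrow> 'e) \<Rightarrow> 'a \<Rightarrow> real" where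
  "wedge12 \<omega> \<beta> X Y Z p =
     \<omega> X p * \<beta> p (Y p) (Z p) - \<omega> Y p * \<beta> p (X p) (Z p) + \<omega> Z p * \<beta> p (X p) (Y p)"

definition metric_dual ::
  "('a::topological_space, 'e::euclidean_space) chart set \<Rightarrow> ('a \<Rightarrow> 'e \<Rightarrow> 'e \<Rightarrow> real) \<Rightarrow>
   (('a \<Rightarrow> 'e) \<Rightarrow> 'a \<Rightarrow> real) \<Rightarrow> ('a \<Rightarrow> 'e) \<Rightarrow> bool" where
  "metric_dual A g \<omega> B \<longleftrightarrow>
     (\<forall>W X. open W \<and> vector_field A W X \<longrightarrow> (\<forall>p\<in>W. g p (B p) (X p) = \<omega> X p))"


section \<open>Almost contact metric and almost Hermitian manifolds\<close>

definition acm_manifold ::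
  "('a::{t2_space, second_countable_topology}, 'e::euclidean_space) chart set \<Rightarrow>
   ('a \<Rightarrow> 'e \<Rightarrow> 'e) \<Rightarrow> ('a \<Rightarrow> 'e) \<Rightarrow> ('a \<Rightarrow> 'e \<Rightarrow> real) \<Rightarrow> ('a \<Rightarrow> 'e \<Rightarrow> 'e \<Rightarrow> real) \<Rightarrow> bool" where
  "acm_manifold A \<phi> \<xi> \<eta> g \<longleftrightarrow>
     smooth_manifold A \<and> riemannian_metric A g \<and>
     tensor11 A \<phi> \<and> vector_field A UNIV \<xi> \<and> one_form A \<eta> \<and>
     (\<forall>p u. \<phi> p (\<phi> p u) = - u + \<eta> p u *\<^sub>R \<xi> p) \<and>
     (\<forall>p. \<eta> p (\<xi> p) = 1) \<and>
     (\<forall>p u v. g p (\<phi> p u) (\<phi> p v) = g p u v - \<eta> p u * \<eta> p v)"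

definition fund_form ::
  "('a \<Rightarrow> 'e \<Rightarrow> 'e \<Rightarrow> real) \<Rightarrow> ('a \<Rightarrow> 'e \<Rightarrow> 'e) \<Rightarrow> 'a \<Rightarrow> 'e \<Rightarrow> 'e \<Rightarrow> real" where
  "fund_form g \<phi> p u v = g p u (\<phi> p v)"

definition lee_form ::
  "nat \<Rightarrow> ('a::topological_space, 'e::euclidean_space) chart set \<Rightarrow> ('a \<Rightarrow> 'e \<Rightarrow> 'e) \<Rightarrow>
   ('a \<Rightarrow> 'e) \<Rightarrow> ('a \<Rightarrow> 'e \<Rightarrow> real) \<Rightarrow> ('a \<Rightarrow> 'e \<Rightarrow> 'e \<Rightarrow> real) \<Rightarrow>
   (('a \<Rightarrow> 'e) \<Rightarrow> ('a \<Rightarrow> 'e) \<Rightarrow> 'a \<Rightarrow> 'e) \<Rightarrow> ('a \<Rightarrow> 'e) \<Rightarrow> 'a \<Rightarrow> real" where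
  "lee_form m A \<phi> \<xi> \<eta> g D X p =
     - 1 / (2 * (real m - 1)) *
         (codiff2 A g D (fund_form g \<phi>) (\<lambda>q. \<phi> q (X q)) p + cov_deriv1 A D \<eta> \<xi> X p)
     + codiff1 A g D \<eta> p / (2 * real m) * \<eta> p (X p)"

definition almost_hermitian_manifold ::
  "('b::{t2_space, second_countable_topology}, 'f::euclidean_space) chart set \<Rightarrow>
   ('b \<Rightarrow> 'f \<Rightarrow> 'f) \<Rightarrow> ('b \<Rightarrow> 'f \<Rightarrow> 'f \<Rightarrow> real) \<Rightarrow> bool" where
  "almost_hermitian_manifold A J g \<longleftrightarrow>
     smooth_manifold A \<and> riemannian_metric A g \<and> tensor11 A J \<and>
     (\<forall>p u. J p (J p u) = - u) \<and>
     (\<forall>p u v. g p (J p u) (J p v) = g p u v)"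


section \<open>Riemannian submersions and the O'Neill invariant\<close>

definition vert ::
  "('a, 'e::euclidean_space) chart set \<Rightarrow> ('b, 'f::euclidean_space) chart set \<Rightarrow>
   ('a \<Rightarrow> 'b) \<Rightarrow> 'a \<Rightarrow> 'e set" where
  "vert A A' \<pi> p = {u. push A A' \<pi> p u = 0}"

definition horiz ::
  "('a, 'e::euclidean_space) chart set \<Rightarrow> ('b, 'f::euclidean_space) chart set \<Rightarrow>
   ('a \<Rightarrow> 'e \<Rightarrow> 'e \<Rightarrow> real) \<Rightarrow> ('a \<Rightarrow> 'b) \<Rightarrow> 'a \<Rightarrow> 'e set" where
  "horiz A A' g \<pi> p = {u. \<forall>v\<in>vert A A' \<pi> p. g p u v = 0}"

definition vproj ::
  "('a, 'e::euclidean_space) chart set \<Rightarrow> ('b, 'f::euclidean_space) chart set \<Rightarrow>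
   ('a \<Rightarrow> 'e \<Rightarrow> 'e \<Rightarrow> real) \<Rightarrow> ('a \<Rightarrow> 'b) \<Rightarrow> 'a \<Rightarrow> 'e \<Rightarrow> 'e" where
  "vproj A A' g \<pi> p u = (THE v. v \<in> vert A A' \<pi> p \<and> u - v \<in> horiz A A' g \<pi> p)"

definition hproj ::
  "('a, 'e::euclidean_space) chart set \<Rightarrow> ('b, 'f::euclidean_space) chart set \<Rightarrow>
   ('a \<Rightarrow> 'e \<Rightarrow> 'e \<Rightarrow> real) \<Rightarrow> ('a \<Rightarrow> 'b) \<Rightarrow> 'a \<Rightarrow> 'e \<Rightarrow> 'e" where
  "hproj A A' g \<pi> p u = (THE w. w \<in> horiz A A' g \<pi> p \<and> u - w \<in> vert A A' \<pi> p)"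

definition vertical_field ::
  "('a, 'e::euclidean_space) chart set \<Rightarrow> ('b, 'f::euclidean_space) chart set \<Rightarrow>
   ('a \<Rightarrow> 'b) \<Rightarrow> ('a \<Rightarrow> 'e) \<Rightarrow> bool" where
  "vertical_field A A' \<pi> U \<longleftrightarrow> vector_field A UNIV U \<and> (\<forall>p. U p \<in> vert A A' \<pi> p)"

definition horizontal_field ::
  "('a, 'e::euclidean_space) chart set \<Rightarrow> ('b, 'f::euclidean_space) chart set \<Rightarrow>
   ('a \<Rightarrow> 'e \<Rightarrow> 'e \<Rightarrow> real) \<Rightarrow> ('a \<Rightarrow> 'b) \<Rightarrow> ('a \<Rightarrow> 'e) \<Rightarrow> bool" where
  "horizontal_field A A' g \<pi> X \<longleftrightarrow> vector_field A UNIV X \<and> (\<forall>p. X p \<in> horiz A A' g \<pi> p)"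

definition riemannian_submersion ::
  "('a::topological_space, 'e::euclidean_space) chart set \<Rightarrow> ('a \<Rightarrow> 'e \<Rightarrow> 'e \<Rightarrow> real) \<Rightarrow>
   ('b::topological_space, 'f::euclidean_space) chart set \<Rightarrow> ('b \<Rightarrow> 'f \<Rightarrow> 'f \<Rightarrow> real) \<Rightarrow>
   ('a \<Rightarrow> 'b) \<Rightarrow> bool" where
  "riemannian_submersion A g A' g' \<pi> \<longleftrightarrow>
     smooth_map A A' \<pi> \<and> surj \<pi> \<and>
     (\<forall>p. surj (push A A' \<pi> p)) \<and>
     (\<forall>p. \<forall>u\<in>horiz A A' g \<pi> p. \<forall>v\<in>horiz A A' g \<pi> p.
        g' (\<pi> p) (push A A' \<pi> p u) (push A A' \<pi> p v) = g p u v)"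

definition contact_complex_submersion ::
  "('a::{t2_space, second_countable_topology}, 'e::euclidean_space) chart set \<Rightarrow>
   ('a \<Rightarrow> 'e \<Rightarrow> 'e) \<Rightarrow> ('a \<Rightarrow> 'e) \<Rightarrow> ('a \<Rightarrow> 'e \<Rightarrow> real) \<Rightarrow> ('a \<Rightarrow> 'e \<Rightarrow> 'e \<Rightarrow> real) \<Rightarrow>
   ('b::{t2_space, second_countable_topology}, 'f::euclidean_space) chart set \<Rightarrow>
   ('b \<Rightarrow> 'f \<Rightarrow> 'f) \<Rightarrow> ('b \<Rightarrow> 'f \<Rightarrow> 'f \<Rightarrow> real) \<Rightarrow> ('a \<Rightarrow> 'b) \<Rightarrow> bool" where
  "contact_complex_submersion A \<phi> \<xi> \<eta> g A' J g' \<pi> \<longleftrightarrow>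
     acm_manifold A \<phi> \<xi> \<eta> g \<and> almost_hermitian_manifold A' J g' \<and>
     riemannian_submersion A g A' g' \<pi> \<and>
     (\<forall>p u. J (\<pi> p) (push A A' \<pi> p u) = push A A' \<pi> p (\<phi> p u))"

definition oneill_A ::
  "('a, 'e::euclidean_space) chart set \<Rightarrow> ('b, 'f::euclidean_space) chart set \<Rightarrow>
   ('a \<Rightarrow> 'e \<Rightarrow> 'e \<Rightarrow> real) \<Rightarrow> (('a \<Rightarrow> 'e) \<Rightarrow> ('a \<Rightarrow> 'e) \<Rightarrow> 'a \<Rightarrow> 'e) \<Rightarrow> ('a \<Rightarrow> 'b) \<Rightarrow>
   ('a \<Rightarrow> 'e) \<Rightarrow> ('a \<Rightarrow> 'e) \<Rightarrow> 'a \<Rightarrow> 'e" where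
  "oneill_A A A' g D \<pi> E F p =
     (let v = vproj A A' g \<pi>; h = hproj A A' g \<pi>;
          hE = (\<lambda>q. h q (E q)); hF = (\<lambda>q. h q (F q)); vF = (\<lambda>q. v q (F q))
      in v p (D hE hF p) + h p (D hE vF p))"

end

theory Submission
  imports Defs
begin

text \<open>
  Write \<open>\<beta>(E, F) = g'(\<pi>\<^sub>*E, \<pi>\<^sub>*F)\<close> and \<open>\<beta>J(E, F) = g'(\<pi>\<^sub>*E, J \<pi>\<^sub>*F)\<close> for the tensors pulled back
  from the base.  Because \<open>\<pi>\<close> is a Riemannian submersion intertwining \<open>\<phi>\<close> and \<open>J\<close>, the metric \<open>g\<close>
  agrees with \<open>\<beta>\<close>, and the fundamental form \<open>\<Phi>\<close> with \<open>\<beta>J\<close>, as soon as one entry is horizontal.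
  Pullbacks do not change along the fibres; the form of this fact used throughout is
  \<open>pullback_identity\<close>: if \<open>U\<close> is vertical at a point then there
  \<open>U(\<beta>(X, Y)) + \<beta>([X, U], Y) + \<beta>(X, [Y, U]) = X(\<beta>(U, Y)) + Y(\<beta>(X, U))\<close>
  for arbitrary fields \<open>X, Y\<close>, projectable or not.  It rests on
  \<open>\<pi>\<^sub>*[X, U] = X(\<pi>\<^sub>*U) - U(\<pi>\<^sub>*X)\<close>, that is, on the symmetry of second derivatives.

  For \<open>\<beta>\<close> the identity gives that \<open>g(\<nabla>\<^sub>XY, U)\<close> is skew in horizontal \<open>X, Y\<close>
  (\<open>nabla_horizontal_skew\<close>) and that \<open>g(\<nabla>\<^sub>XU, Y)\<close> is skew as well (\<open>nabla_vertical_skew\<close>).  For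
  \<open>\<beta>J\<close> it removes most terms of \<open>d\<Phi>(X, Y, U)\<close>, which becomes \<open>-2 g(\<nabla>\<^sub>XY, \<phi>U)\<close> or, equivalently,
  \<open>2 g(\<nabla>\<^sub>X(\<phi>U), Y)\<close>.  On the other side \<open>(\<omega> \<and> \<Phi>)(X, Y, U) = \<omega>(U) \<Phi>(X, Y)\<close>, since \<open>\<Phi>\<close> does not
  pair horizontal with vertical vectors.  So \<open>d\<Phi> = -2 \<omega> \<and> \<Phi>\<close> determines the invariant \<open>A\<close> on
  \<open>\<phi>\<close> of the vertical space, and \<open>U = -\<phi>\<phi>U + \<eta>(U) \<xi>\<close> leaves only the \<open>\<xi>\<close>-part free: this is the
  content of the formulas for \<open>A\<^sub>XU\<close> and \<open>A\<^sub>XY\<close> (\<open>nabla_vertical\<close>, \<open>nabla_horizontal\<close>), and the last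
  two formulas follow from these algebraically.

  For \<open>U = \<xi>\<close> the form \<open>d\<Phi>(X, Y, \<xi>)\<close> vanishes on horizontal \<open>X, Y\<close> (\<open>d\<Phi>_\<xi>\<close>), because \<open>\<Phi>\<close>
  annihilates \<open>\<xi>\<close> and agrees with the pullback \<open>\<beta>J\<close> to first order at horizontal pairs.
  As the base has positive dimension, \<open>\<Phi>\<close> is nonzero on horizontal vectors, so \<open>\<omega>(\<xi>) = 0\<close>; and the
  definition of the Lee form says \<open>\<omega>(\<xi>) = \<delta>\<eta>/2m\<close>.
\<close>

section \<open>Calculus on open subsets of Euclidean space\<close>

abbreviation Der :: "('e::real_normed_vector \<Rightarrow> 'b::real_normed_vector) \<Rightarrow> 'e \<Rightarrow> 'e \<Rightarrow> 'b" where
  "Der f z \<equiv> frechet_derivative f (at z)"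

lemma Der_eq: "(f has_derivative f') (at x) \<Longrightarrow> Der f x = f'"
  by (metis frechet_derivative_at)

lemma Der_works: "f differentiable (at x) \<Longrightarrow> (f has_derivative Der f x) (at x)"
  using frechet_derivative_works by blast

lemma Der_cong:
  assumes "open S" "x \<in> S" "\<And>y. y \<in> S \<Longrightarrow> f y = g y"
  shows "Der f x = Der g x"
proof -
  have "(f has_derivative F) (at x) \<longleftrightarrow> (g has_derivative F) (at x)" for F
    using assms has_derivative_transform_within_open[of f F x UNIV S g]
      has_derivative_transform_within_open[of g F x UNIV S f] by auto
  then show ?thesis by (simp add: frechet_derivative_def)
qed

lemma differentiable_cong_open:
  assumes "open S" "x \<in> S" "\<And>y. y \<in> S \<Longrightarrow> f y = g y" "f differentiable (at x)"
  shows "g differentiable (at x)"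
  using assms has_derivative_transform_within_open[of f _ x UNIV S g]
  unfolding differentiable_def by blast

lemma Ck_on_cong:
  assumes "open S"
  shows "Ck_on k S f \<Longrightarrow> (\<And>x. x \<in> S \<Longrightarrow> f x = g x) \<Longrightarrow> Ck_on k S g"
proof (induction k arbitrary: f g)
  case 0
  then show ?case using continuous_on_cong by fastforce
next
  case (Suc k)
  have "g differentiable (at x)" if "x \<in> S" for x
    using Suc.prems differentiable_cong_open[OF assms that, of f g] that by auto
  moreover have "Ck_on k S (\<lambda>x. Der g x v)" for v
  proof (rule Suc.IH)
    show "Ck_on k S (\<lambda>x. Der f x v)" using Suc.prems by simp
    show "Der f x v = Der g x v" if "x \<in> S" for x
      using Der_cong[OF assms that, of f g] Suc.prems by simp
  qed
  ultimately show ?case by simp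
qed

lemma Ck_on_subset: "Ck_on k S f \<Longrightarrow> T \<subseteq> S \<Longrightarrow> Ck_on k T f"
  by (induction k arbitrary: f) (auto intro: continuous_on_subset)

lemma Ck_on_SucD: "Ck_on (Suc k) S f \<Longrightarrow> Ck_on k S f"
proof (induction k arbitrary: f)
  case 0
  then show ?case
    by (auto intro!: continuous_at_imp_continuous_on differentiable_imp_continuous_within)
qed simp

lemma Ck_on_const: "Ck_on k S (\<lambda>x. c)"
  by (induction k arbitrary: c) auto

lemma Ck_on_add:
  assumes "open S"
  shows "Ck_on k S f \<Longrightarrow> Ck_on k S g \<Longrightarrow> Ck_on k S (\<lambda>x. f x + g x)"
proof (induction k arbitrary: f g)
  case (Suc k)
  have "Ck_on k S (\<lambda>x. Der (\<lambda>x. f x + g x) x v)" for v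
  proof (rule Ck_on_cong[OF assms Suc.IH])
    show "Ck_on k S (\<lambda>x. Der f x v)" "Ck_on k S (\<lambda>x. Der g x v)" using Suc.prems by auto
    show "Der f x v + Der g x v = Der (\<lambda>x. f x + g x) x v" if "x \<in> S" for x
      using Der_eq[OF has_derivative_add[OF Der_works[of f x] Der_works[of g x]]]
        Suc.prems that by simp
  qed
  then show ?case using Suc.prems by simp
qed (auto intro: continuous_on_add)

lemma Ck_on_sum:
  assumes "open S" "\<And>i. i \<in> I \<Longrightarrow> Ck_on k S (f i)"
  shows "Ck_on k S (\<lambda>x. \<Sum>i\<in>I. f i x)"
  using assms(2)
  by (induction I rule: infinite_finite_induct) (auto intro: Ck_on_const Ck_on_add[OF assms(1)])

lemma Ck_on_bounded_linear:
  assumes "open S" "bounded_linear L"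
  shows "Ck_on k S f \<Longrightarrow> Ck_on k S (\<lambda>x. L (f x))"
proof (induction k arbitrary: f)
  case 0
  then show ?case by (simp add: assms(2) bounded_linear.continuous_on)
next
  case (Suc k)
  have 1: "((\<lambda>x. L (f x)) has_derivative (\<lambda>v. L (Der f x v))) (at x)" if "x \<in> S" for x
    using bounded_linear.has_derivative[OF assms(2) Der_works[of f x]] Suc.prems that by simp
  have "Ck_on k S (\<lambda>x. Der (\<lambda>x. L (f x)) x v)" for v
  proof (rule Ck_on_cong[OF assms(1) Suc.IH])
    show "Ck_on k S (\<lambda>x. Der f x v)" using Suc.prems by auto
    show "L (Der f x v) = Der (\<lambda>x. L (f x)) x v" if "x \<in> S" for x
      using Der_eq[OF 1[OF that]] by simp
  qed
  then show ?case using 1 by (auto simp: differentiable_def)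
qed

lemma Ck_on_scaleR:
  fixes f :: "'e::euclidean_space \<Rightarrow> real"
  assumes "open S"
  shows "Ck_on k S f \<Longrightarrow> Ck_on k S g \<Longrightarrow> Ck_on k S (\<lambda>x. f x *\<^sub>R g x)"
proof (induction k arbitrary: f g)
  case 0
  then show ?case by (simp add: continuous_on_scaleR)
next
  case (Suc k)
  have 1: "((\<lambda>x. f x *\<^sub>R g x) has_derivative (\<lambda>v. f x *\<^sub>R Der g x v + Der f x v *\<^sub>R g x)) (at x)"
    if "x \<in> S" for x
    using has_derivative_scaleR[OF Der_works[of f x] Der_works[of g x]] Suc.prems that by simp
  have "Ck_on k S (\<lambda>x. Der (\<lambda>x. f x *\<^sub>R g x) x v)" for v
  proof (rule Ck_on_cong[OF assms])
    have "Ck_on k S f" "Ck_on k S g" by (fact Suc.prems[THEN Ck_on_SucD])+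
    moreover have "Ck_on k S (\<lambda>x. Der f x v)" "Ck_on k S (\<lambda>x. Der g x v)"
      using Suc.prems by auto
    ultimately show "Ck_on k S (\<lambda>x. f x *\<^sub>R Der g x v + Der f x v *\<^sub>R g x)"
      by (intro Ck_on_add Suc.IH assms)
    show "f x *\<^sub>R Der g x v + Der f x v *\<^sub>R g x = Der (\<lambda>x. f x *\<^sub>R g x) x v" if "x \<in> S" for x
      using Der_eq[OF 1[OF that]] by simp
  qed
  then show ?case using 1 by (auto simp: differentiable_def)
qed

lemma linear_expansion:
  fixes L :: "'e::euclidean_space \<Rightarrow> 'b::real_vector"
  assumes "linear L"
  shows "L v = (\<Sum>b\<in>Basis. (v \<bullet> b) *\<^sub>R L b)"
  using linear_sum[OF assms, of "\<lambda>b. (v \<bullet> b) *\<^sub>R b" Basis]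
  by (simp add: linear_scale[OF assms] euclidean_representation)

lemma Ck_on_compose:
  fixes f :: "'e::euclidean_space \<Rightarrow> 'f::euclidean_space"
  assumes "open S" "open T"
  shows "Ck_on k S f \<Longrightarrow> Ck_on k T g \<Longrightarrow> f ` S \<subseteq> T \<Longrightarrow> Ck_on k S (\<lambda>x. g (f x))"
proof (induction k arbitrary: g)
  case 0
  then show ?case by (metis Ck_on.simps(1) continuous_on_compose2)
next
  case (Suc k)
  have 1: "((\<lambda>x. g (f x)) has_derivative (\<lambda>v. Der g (f x) (Der f x v))) (at x)" if "x \<in> S" for x
    using has_derivative_compose[OF Der_works[of f x] Der_works[of g "f x"]] Suc.prems that by auto
  have "Ck_on k S (\<lambda>x. Der (\<lambda>x. g (f x)) x v)" for v
  proof (rule Ck_on_cong[OF assms(1)])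
    show "Ck_on k S (\<lambda>x. \<Sum>b\<in>Basis. (Der f x v \<bullet> b) *\<^sub>R Der g (f x) b)"
    proof (intro Ck_on_sum Ck_on_scaleR assms(1))
      show "Ck_on k S (\<lambda>x. Der f x v \<bullet> b)" for b
        by (rule Ck_on_bounded_linear[OF assms(1) bounded_linear_inner_left]) (use Suc.prems in auto)
      show "Ck_on k S (\<lambda>x. Der g (f x) b)" for b
        using Suc.IH[OF Ck_on_SucD[OF Suc.prems(1)] _ Suc.prems(3), of "\<lambda>y. Der g y b"] Suc.prems(2)
        by simp
    qed
    show "(\<Sum>b\<in>Basis. (Der f x v \<bullet> b) *\<^sub>R Der g (f x) b) = Der (\<lambda>x. g (f x)) x v" if "x \<in> S" for x
    proof -
      have "linear (Der g (f x))" using Suc.prems that by (intro linear_frechet_derivative) auto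
      then show ?thesis using linear_expansion[of "Der g (f x)" "Der f x v"] Der_eq[OF 1[OF that]] by simp
    qed
  qed
  then show ?case using 1 by (auto simp: differentiable_def)
qed

lemma smooth_on_cong:
  "smooth_on S f \<Longrightarrow> open S \<Longrightarrow> (\<And>x. x \<in> S \<Longrightarrow> f x = g x) \<Longrightarrow> smooth_on S g"
  unfolding smooth_on_def using Ck_on_cong by blast

lemma smooth_on_subset: "smooth_on S f \<Longrightarrow> T \<subseteq> S \<Longrightarrow> smooth_on T f"
  unfolding smooth_on_def using Ck_on_subset by blast

lemma smooth_on_compose:
  fixes f :: "'e::euclidean_space \<Rightarrow> 'f::euclidean_space"
  shows "smooth_on S f \<Longrightarrow> smooth_on T g \<Longrightarrow> open S \<Longrightarrow> open T \<Longrightarrow> f ` S \<subseteq> T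
    \<Longrightarrow> smooth_on S (\<lambda>x. g (f x))"
  unfolding smooth_on_def using Ck_on_compose by blast

lemma smooth_on_Der: "smooth_on S f \<Longrightarrow> smooth_on S (\<lambda>x. Der f x v)"
  unfolding smooth_on_def by (metis Ck_on.simps(2))

lemma smooth_on_differentiable: "smooth_on S f \<Longrightarrow> x \<in> S \<Longrightarrow> f differentiable (at x)"
  unfolding smooth_on_def by (metis Ck_on.simps(2))

lemma smooth_on_continuous: "smooth_on S f \<Longrightarrow> continuous_on S f"
  unfolding smooth_on_def by (metis Ck_on.simps(1))

lemma smooth_on_inner: "smooth_on S f \<Longrightarrow> open S \<Longrightarrow> smooth_on S (\<lambda>x. f x \<bullet> b)"
  unfolding smooth_on_def using Ck_on_bounded_linear[OF _ bounded_linear_inner_left] by blast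


text \<open>The second difference of \<open>f\<close> over a small parallelogram is, by the mean value theorem
  applied in each of the two directions, a value of the mixed second derivative.  Its symmetry in
  the two directions is what makes mixed derivatives commute.\<close>

lemma second_difference:
  fixes f :: "'e::euclidean_space \<Rightarrow> real"
  assumes f: "smooth_on S f" and h: "h > 0"
    and S: "\<And>s t. 0 \<le> s \<Longrightarrow> s \<le> h \<Longrightarrow> 0 \<le> t \<Longrightarrow> t \<le> h \<Longrightarrow> z + s *\<^sub>R v + t *\<^sub>R w \<in> S"
  shows "\<exists>s t. 0 \<le> s \<and> s \<le> h \<and> 0 \<le> t \<and> t \<le> h \<and>
    f (z + h *\<^sub>R v + h *\<^sub>R w) - f (z + h *\<^sub>R v) - f (z + h *\<^sub>R w) + f z =
    h * h * Der (\<lambda>y. Der f y v) (z + s *\<^sub>R v + t *\<^sub>R w) w"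
proof -
  have line: "((\<lambda>s. F (y + s *\<^sub>R u)) has_real_derivative Der F (y + s *\<^sub>R u) u) (at s)"
    if "smooth_on S F" "y + s *\<^sub>R u \<in> S" for F :: "'e \<Rightarrow> real" and y u s
  proof -
    have F: "(F has_derivative Der F (y + s *\<^sub>R u)) (at (y + s *\<^sub>R u))"
      using Der_works smooth_on_differentiable that by blast
    have "((\<lambda>s. y + s *\<^sub>R u) has_derivative (\<lambda>s. s *\<^sub>R u)) (at s)"
      by (auto intro!: derivative_eq_intros)
    from has_derivative_compose[OF this F]
    have "((\<lambda>s. F (y + s *\<^sub>R u)) has_derivative (\<lambda>t. Der F (y + s *\<^sub>R u) (t *\<^sub>R u))) (at s)" .
    moreover have "(\<lambda>t. Der F (y + s *\<^sub>R u) (t *\<^sub>R u)) = (*) (Der F (y + s *\<^sub>R u) u)"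
      using has_derivative_linear[OF F] by (auto simp: linear_scale)
    ultimately show ?thesis by (simp add: has_field_derivative_def)
  qed
  have sw: "z + s *\<^sub>R v + h *\<^sub>R w = z + h *\<^sub>R w + s *\<^sub>R v" for s by (simp add: algebra_simps)
  define q where "q = (\<lambda>s. f (z + h *\<^sub>R w + s *\<^sub>R v) - f (z + s *\<^sub>R v))"
  have "(q has_real_derivative Der f (z + h *\<^sub>R w + s *\<^sub>R v) v - Der f (z + s *\<^sub>R v) v) (at s)"
    if "0 \<le> s" "s \<le> h" for s
    unfolding q_def
    by (intro DERIV_diff line[OF f]) (use S[of s h] S[of s 0] that h in \<open>auto simp: sw\<close>)
  from MVT2[OF h this] obtain s where s: "0 < s" "s < h" and
    qs: "q h - q 0 = h * (Der f (z + h *\<^sub>R w + s *\<^sub>R v) v - Der f (z + s *\<^sub>R v) v)"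
    by auto
  have "((\<lambda>t. Der f (z + s *\<^sub>R v + t *\<^sub>R w) v) has_real_derivative
      Der (\<lambda>y. Der f y v) (z + s *\<^sub>R v + t *\<^sub>R w) w) (at t)" if "0 \<le> t" "t \<le> h" for t
    by (rule line[OF smooth_on_Der[OF f]]) (use S s that in auto)
  from MVT2[OF h this] obtain t where t: "0 < t" "t < h" and
    "Der f (z + s *\<^sub>R v + h *\<^sub>R w) v - Der f (z + s *\<^sub>R v) v
      = h * Der (\<lambda>y. Der f y v) (z + s *\<^sub>R v + t *\<^sub>R w) w"
    by auto
  then have "q h - q 0 = h * h * Der (\<lambda>y. Der f y v) (z + s *\<^sub>R v + t *\<^sub>R w) w"
    using qs by (simp add: sw)
  then show ?thesis using s t
    by (intro exI[of _ s] exI[of _ t]) (auto simp: q_def sw)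
qed

lemma mixed_derivatives_commute_real:
  fixes f :: "'e::euclidean_space \<Rightarrow> real"
  assumes f: "smooth_on S f" and S: "open S" "z \<in> S"
  shows "Der (\<lambda>y. Der f y v) z w = Der (\<lambda>y. Der f y w) z v"
proof (rule ccontr)
  define P Q where "P = (\<lambda>y. Der (\<lambda>y. Der f y v) y w)" and "Q = (\<lambda>y. Der (\<lambda>y. Der f y w) y v)"
  assume "\<not> ?thesis"
  then have "\<bar>P z - Q z\<bar> / 2 > 0" (is "?e > 0") by (simp add: P_def Q_def)
  have "isCont P z" "isCont Q z"
    using smooth_on_continuous[OF smooth_on_Der[OF smooth_on_Der[OF f]]] S
    by (auto simp: P_def Q_def continuous_on_eq_continuous_at)
  then obtain d1 d2 where d: "d1 > 0" "\<And>y. dist y z < d1 \<Longrightarrow> dist (P y) (P z) < ?e"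
    "d2 > 0" "\<And>y. dist y z < d2 \<Longrightarrow> dist (Q y) (Q z) < ?e"
    using \<open>?e > 0\<close> unfolding continuous_at_eps_delta by metis
  obtain d3 where d3: "d3 > 0" "ball z d3 \<subseteq> S" using S openE by blast
  define r where "r = min d1 (min d2 d3)"
  have "r > 0" using d d3 by (simp add: r_def)
  define h where "h = r / (norm v + norm w + 1)"
  have "h > 0" using \<open>r > 0\<close> by (simp add: h_def add_nonneg_pos)
  have near: "dist (z + s *\<^sub>R v + t *\<^sub>R w) z < r" if "0 \<le> s" "s \<le> h" "0 \<le> t" "t \<le> h" for s t
  proof -
    have "dist (z + s *\<^sub>R v + t *\<^sub>R w) z \<le> s * norm v + t * norm w"
      using norm_triangle_ineq[of "s *\<^sub>R v" "t *\<^sub>R w"] that by (simp add: dist_norm add.assoc)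
    also have "\<dots> \<le> h * norm v + h * norm w"
      using that by (intro add_mono mult_right_mono) auto
    also have "\<dots> < h * (norm v + norm w + 1)" using \<open>h > 0\<close> by (simp add: algebra_simps)
    also have "\<dots> = r"
    proof -
      have "norm v + norm w + 1 > 0" by (simp add: add_nonneg_pos)
      then show ?thesis by (simp add: h_def)
    qed
    finally show ?thesis .
  qed
  have inS: "z + s *\<^sub>R v + t *\<^sub>R w \<in> S" if "0 \<le> s" "s \<le> h" "0 \<le> t" "t \<le> h" for s t
    using near[OF that] d3 by (auto simp: r_def dist_commute)
  have sw: "z + a *\<^sub>R w + b *\<^sub>R v = z + b *\<^sub>R v + a *\<^sub>R w" for a b by (simp add: algebra_simps)
  obtain s t where 1: "0 \<le> s" "s \<le> h" "0 \<le> t" "t \<le> h"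
    "f (z + h *\<^sub>R v + h *\<^sub>R w) - f (z + h *\<^sub>R v) - f (z + h *\<^sub>R w) + f z
      = h * h * P (z + s *\<^sub>R v + t *\<^sub>R w)"
    using second_difference[OF f \<open>h > 0\<close> inS] unfolding P_def by blast
  obtain s' t' where 2: "0 \<le> s'" "s' \<le> h" "0 \<le> t'" "t' \<le> h"
    "f (z + h *\<^sub>R w + h *\<^sub>R v) - f (z + h *\<^sub>R w) - f (z + h *\<^sub>R v) + f z
      = h * h * Q (z + s' *\<^sub>R w + t' *\<^sub>R v)"
    using second_difference[OF f \<open>h > 0\<close>, of z w v] inS sw unfolding Q_def by metis
  have "P (z + s *\<^sub>R v + t *\<^sub>R w) = Q (z + s' *\<^sub>R w + t' *\<^sub>R v)"
    using 1(5) 2(5) \<open>h > 0\<close> sw by (simp add: algebra_simps)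
  moreover have "dist (P (z + s *\<^sub>R v + t *\<^sub>R w)) (P z) < ?e"
    using d(2) near[OF 1(1-4)] by (simp add: r_def)
  moreover have "dist (Q (z + s' *\<^sub>R w + t' *\<^sub>R v)) (Q z) < ?e"
    using d(4) near[OF 2(3,4,1,2)] by (simp add: r_def sw)
  ultimately show False
    using dist_triangle_half_r[of "P (z + s *\<^sub>R v + t *\<^sub>R w)" "P z" "\<bar>P z - Q z\<bar>" "Q z"]
    by (simp add: dist_real_def)
qed

lemma Der_inner:
  assumes "f differentiable (at z)"
  shows "Der (\<lambda>y. f y \<bullet> b) z v = Der f z v \<bullet> b"
  using Der_eq[OF has_derivative_inner_left[OF Der_works[OF assms]]] by simp

lemma mixed_derivatives_commute:
  fixes f :: "'e::euclidean_space \<Rightarrow> 'f::euclidean_space"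
  assumes f: "smooth_on S f" and S: "open S" "z \<in> S"
  shows "Der (\<lambda>y. Der f y v) z w = Der (\<lambda>y. Der f y w) z v"
proof (rule euclidean_eqI)
  fix b :: 'f
  have comp: "Der (\<lambda>y. Der f y v) z w \<bullet> b = Der (\<lambda>y. Der (\<lambda>y. f y \<bullet> b) y v) z w" for v w
  proof -
    have "Der (\<lambda>y. Der f y v) z w \<bullet> b = Der (\<lambda>y. Der f y v \<bullet> b) z w"
      using Der_inner smooth_on_differentiable[OF smooth_on_Der[OF f] S(2)] by metis
    also have "\<dots> = Der (\<lambda>y. Der (\<lambda>y. f y \<bullet> b) y v) z w"
      using Der_cong[OF S, of "\<lambda>y. Der f y v \<bullet> b" "\<lambda>y. Der (\<lambda>y. f y \<bullet> b) y v"]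
        Der_inner smooth_on_differentiable[OF f] by metis
    finally show ?thesis .
  qed
  show "Der (\<lambda>y. Der f y v) z w \<bullet> b = Der (\<lambda>y. Der f y w) z v \<bullet> b"
    unfolding comp by (rule mixed_derivatives_commute_real[OF smooth_on_inner[OF f S(1)] S])
qed

text \<open>The derivative of \<open>y \<mapsto> Df\<^sub>y(u(y))\<close> splits into the part from \<open>u\<close> and a second derivative of
  \<open>f\<close>; expanding \<open>u\<close> in the standard basis reduces it to derivatives in constant directions.\<close>

lemma has_derivative_Der_field:
  fixes f :: "'e::euclidean_space \<Rightarrow> 'f::euclidean_space" and u :: "'e \<Rightarrow> 'e"
  assumes f: "smooth_on S f" and S: "open S" "z \<in> S" and u: "u differentiable (at z)"
  shows "((\<lambda>y. Der f y (u y)) has_derivative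
    (\<lambda>v. Der f z (Der u z v) + Der (\<lambda>y. Der f y (u z)) z v)) (at z)"
proof -
  have lin: "linear (Der f y)" if "y \<in> S" for y
    using linear_frechet_derivative smooth_on_differentiable[OF f that] by blast
  have d: "(\<lambda>y. Der f y b) differentiable (at z)" for b
    using smooth_on_differentiable[OF smooth_on_Der[OF f] S(2)] .
  have "((\<lambda>y. \<Sum>b\<in>Basis. (w \<bullet> b) *\<^sub>R Der f y b) has_derivative
      (\<lambda>v. \<Sum>b\<in>Basis. (w \<bullet> b) *\<^sub>R Der (\<lambda>y. Der f y b) z v)) (at z)" for w
    by (intro has_derivative_sum has_derivative_scaleR_right Der_works d)
  from Der_eq[OF this] have second:
    "Der (\<lambda>y. Der f y w) z = (\<lambda>v. \<Sum>b\<in>Basis. (w \<bullet> b) *\<^sub>R Der (\<lambda>y. Der f y b) z v)" for w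
    using Der_cong[OF S, of "\<lambda>y. Der f y w" "\<lambda>y. \<Sum>b\<in>Basis. (w \<bullet> b) *\<^sub>R Der f y b"]
      linear_expansion[OF lin] by metis
  have "((\<lambda>y. \<Sum>b\<in>Basis. (u y \<bullet> b) *\<^sub>R Der f y b) has_derivative
      (\<lambda>v. \<Sum>b\<in>Basis. (u z \<bullet> b) *\<^sub>R Der (\<lambda>y. Der f y b) z v + (Der u z v \<bullet> b) *\<^sub>R Der f z b)) (at z)"
    by (intro has_derivative_sum has_derivative_scaleR has_derivative_inner_left Der_works d u)
  moreover have "(\<Sum>b\<in>Basis. (u z \<bullet> b) *\<^sub>R Der (\<lambda>y. Der f y b) z v + (Der u z v \<bullet> b) *\<^sub>R Der f z b)
      = Der f z (Der u z v) + Der (\<lambda>y. Der f y (u z)) z v" for v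
    using linear_expansion[OF lin[OF S(2)], of "Der u z v"] 
    by (simp add: second[of "u z"] sum.distrib)
  ultimately have "((\<lambda>y. \<Sum>b\<in>Basis. (u y \<bullet> b) *\<^sub>R Der f y b) has_derivative
      (\<lambda>v. Der f z (Der u z v) + Der (\<lambda>y. Der f y (u z)) z v)) (at z)"
    by (simp only:)
  then show ?thesis
    by (rule has_derivative_transform_within_open[OF _ S]) (rule linear_expansion[OF lin, symmetric])
qed

text \<open>The image of a Lie bracket under a smooth map, in coordinates: the symmetric second
  derivative of \<open>f\<close> cancels.\<close>

lemma Der_bracket:
  fixes f :: "'e::euclidean_space \<Rightarrow> 'f::euclidean_space"
  assumes f: "smooth_on S f" and S: "open S" "z \<in> S"
    and x: "x differentiable (at z)" and u: "u differentiable (at z)"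
  shows "Der f z (Der u z (x z) - Der x z (u z)) =
    Der (\<lambda>y. Der f y (u y)) z (x z) - Der (\<lambda>y. Der f y (x y)) z (u z)"
proof -
  have "linear (Der f z)"
    using linear_frechet_derivative smooth_on_differentiable[OF f S(2)] by blast
  then show ?thesis
    using Der_eq[OF has_derivative_Der_field[OF f S x]] Der_eq[OF has_derivative_Der_field[OF f S u]]
      mixed_derivatives_commute[OF f S, of "u z" "x z"]
    by (simp add: linear_diff)
qed

text \<open>In the next lemma \<open>a\<close>, \<open>b\<close>, \<open>k\<close> stand for the images \<open>\<pi>\<^sub>*X\<close>, \<open>\<pi>\<^sub>*Y\<close>, \<open>\<pi>\<^sub>*U\<close> in
  coordinates and \<open>H\<close> for the coefficients of a bilinear form pulled back along \<open>\<pi>\<close>.  The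
  derivatives of \<open>H\<close> along \<open>x\<close> and \<open>w\<close> come with a factor \<open>k z = 0\<close>, and the one along \<open>u\<close> vanishes, so
  the product rule gives the identity term by term.\<close>

lemma product_rule_identity:
  fixes a b k :: "'e::euclidean_space \<Rightarrow> 'f::euclidean_space" and H :: "'f \<Rightarrow> 'f \<Rightarrow> 'e \<Rightarrow> real"
  assumes a: "a differentiable (at z)" and b: "b differentiable (at z)"
    and k: "k differentiable (at z)" "k z = 0"
    and H: "\<And>i j. i \<in> Basis \<Longrightarrow> j \<in> Basis \<Longrightarrow> H i j differentiable (at z)"
    and Hu: "\<And>i j. i \<in> Basis \<Longrightarrow> j \<in> Basis \<Longrightarrow> Der (H i j) z u = 0"
  defines "T \<equiv> \<lambda>y v w. \<Sum>i\<in>Basis. \<Sum>j\<in>Basis. H i j y * (v \<bullet> i) * (w \<bullet> j)"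
  shows "Der (\<lambda>y. T y (a y) (b y)) z u + T z (Der k z x - Der a z u) (b z)
      + T z (a z) (Der k z w - Der b z u)
    = Der (\<lambda>y. T y (k y) (b y)) z x + Der (\<lambda>y. T y (a y) (k y)) z w"
    and "(\<lambda>y. T y (a y) (b y)) differentiable (at z)"
proof -
  have TD: "((\<lambda>y. T y (p y) (q y)) has_derivative (\<lambda>v. \<Sum>i\<in>Basis. \<Sum>j\<in>Basis.
      H i j z * (p z \<bullet> i) * (Der q z v \<bullet> j) +
      (H i j z * (Der p z v \<bullet> i) + Der (H i j) z v * (p z \<bullet> i)) * (q z \<bullet> j))) (at z)"
    if "p differentiable (at z)" "q differentiable (at z)" for p q
    unfolding T_def using that H
    by (intro has_derivative_sum has_derivative_mult has_derivative_inner_left Der_works) blast+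
  show "(\<lambda>y. T y (a y) (b y)) differentiable (at z)"
    using TD[OF a b] by (auto simp: differentiable_def)
  show "Der (\<lambda>y. T y (a y) (b y)) z u + T z (Der k z x - Der a z u) (b z)
      + T z (a z) (Der k z w - Der b z u)
    = Der (\<lambda>y. T y (k y) (b y)) z x + Der (\<lambda>y. T y (a y) (k y)) z w"
    unfolding Der_eq[OF TD[OF a b]] Der_eq[OF TD[OF k(1) b]] Der_eq[OF TD[OF a k(1)]]
    unfolding T_def sum.distrib[symmetric]
    by (intro sum.cong refl) (simp add: Hu k(2) inner_diff_left algebra_simps)
qed

section \<open>Charts, components and coordinate fields\<close>

lemma chart_atD:
  assumes "smooth_manifold A"
  shows "chart_at A p \<in> A" "p \<in> cdom (chart_at A p)"
proof -
  have "\<exists>c. c \<in> A \<and> p \<in> cdom c" using assms unfolding smooth_manifold_def by blast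
  from someI_ex[OF this] show "chart_at A p \<in> A" "p \<in> cdom (chart_at A p)"
    by (auto simp: chart_at_def)
qed

lemma chartD:
  assumes "smooth_manifold A" "c \<in> A"
  shows chart_open: "open (cdom c)" "open (cmap c ` cdom c)"
    and cinv_cmap: "\<And>q. q \<in> cdom c \<Longrightarrow> cinv c (cmap c q) = q"
    and chart_open_image: "\<And>W. open W \<Longrightarrow> open (cmap c ` (cdom c \<inter> W))"
proof -
  have o: "open (cdom c)" "open (cmap c ` cdom c)"
    and hom: "homeomorphism (cdom c) (cmap c ` cdom c) (cmap c) (cinv c)"
    using assms unfolding smooth_manifold_def by auto
  show "open (cdom c)" "open (cmap c ` cdom c)" by fact+
  show "cinv c (cmap c q) = q" if "q \<in> cdom c" for q
    using hom that by (simp add: homeomorphism_def)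
  show "open (cmap c ` (cdom c \<inter> W))" if "open W" for W
  proof -
    have "openin (top_of_set (cdom c)) (cdom c \<inter> W)" using that by (simp add: openin_open_Int)
    from homeomorphism_imp_open_map[OF hom this] show ?thesis
      using o(2) openin_open_trans by blast
  qed
qed

lemma smooth_map_id:
  assumes "smooth_manifold A"
  shows "smooth_map A A (\<lambda>x. x)"
  using assms unfolding smooth_manifold_def smooth_map_def
  by (auto simp: o_def vimage_def)

text \<open>The differential of a map read in four charts: changing the charts in the source and in the
  target composes it with the differentials of the two transition maps.\<close>

lemma Der_change_charts:
  fixes A :: "('a::{t2_space, second_countable_topology}, 'e::euclidean_space) chart set"
    and A' :: "('b::{t2_space, second_countable_topology}, 'f::euclidean_space) chart set"
  assumes sm: "smooth_manifold A" "smooth_manifold A'" and f: "smooth_map A A' f"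
    and c: "c \<in> A" "c2 \<in> A" "q \<in> cdom c" "q \<in> cdom c2"
    and d: "d \<in> A'" "d2 \<in> A'" "f q \<in> cdom d" "f q \<in> cdom d2"
  shows "Der (cmap d2 \<circ> f \<circ> cinv c) (cmap c q) v =
    Der (cmap d2 \<circ> cinv d) (cmap d (f q))
      (Der (cmap d \<circ> f \<circ> cinv c2) (cmap c2 q) (Der (cmap c2 \<circ> cinv c) (cmap c q) v))"
proof -
  have fo: "open (f -` V)" if "open V" for V
    using f that unfolding smooth_map_def by (simp add: continuous_on_open_vimage)
  note cd = chartD[OF sm(1) c(1)] chartD[OF sm(1) c(2)] chartD[OF sm(2) d(1)] chartD[OF sm(2) d(2)]
  define N where "N = cmap c ` (cdom c \<inter> (cdom c2 \<inter> f -` (cdom d \<inter> cdom d2)))"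
  have N: "open N" "cmap c q \<in> N"
    unfolding N_def using c d cd by (auto intro!: chartD(4)[OF sm(1)] fo)
  have t: "(cmap c2 \<circ> cinv c) differentiable (at (cmap c q))"
    by (rule smooth_on_differentiable[of "cmap c ` (cdom c \<inter> cdom c2)"])
      (use sm(1) c in \<open>auto simp: smooth_manifold_def\<close>)
  have t': "(cmap d2 \<circ> cinv d) differentiable (at (cmap d (f q)))"
    by (rule smooth_on_differentiable[of "cmap d ` (cdom d \<inter> cdom d2)"])
      (use sm(2) d in \<open>auto simp: smooth_manifold_def\<close>)
  have m: "(cmap d \<circ> f \<circ> cinv c2) differentiable (at (cmap c2 q))"
    by (rule smooth_on_differentiable[of "cmap c2 ` (cdom c2 \<inter> f -` cdom d)"])
      (use f c d in \<open>auto simp: smooth_map_def\<close>)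
  have e: "cinv c (cmap c q) = q" "cinv c2 (cmap c2 q) = q" using cd c by auto
  have "Der (cmap d2 \<circ> f \<circ> cinv c) (cmap c q) =
      Der (\<lambda>z. (cmap d2 \<circ> cinv d) ((cmap d \<circ> f \<circ> cinv c2) ((cmap c2 \<circ> cinv c) z))) (cmap c q)"
    by (rule Der_cong[OF N]) (auto simp: N_def cd)
  also have "\<dots> = (\<lambda>v. Der (cmap d2 \<circ> cinv d) (cmap d (f q))
      (Der (cmap d \<circ> f \<circ> cinv c2) (cmap c2 q) (Der (cmap c2 \<circ> cinv c) (cmap c q) v)))"
  proof (rule Der_eq)
    have "((\<lambda>z. (cmap d \<circ> f \<circ> cinv c2) ((cmap c2 \<circ> cinv c) z)) has_derivative
        (\<lambda>v. Der (cmap d \<circ> f \<circ> cinv c2) (cmap c2 q) (Der (cmap c2 \<circ> cinv c) (cmap c q) v)))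
        (at (cmap c q))"
      by (rule has_derivative_compose[OF Der_works[OF t]]) (use Der_works[OF m] e in \<open>simp add: o_def\<close>)
    from has_derivative_compose[OF this, of "cmap d2 \<circ> cinv d" "Der (cmap d2 \<circ> cinv d) (cmap d (f q))"]
    show "((\<lambda>z. (cmap d2 \<circ> cinv d) ((cmap d \<circ> f \<circ> cinv c2) ((cmap c2 \<circ> cinv c) z))) has_derivative
      (\<lambda>v. Der (cmap d2 \<circ> cinv d) (cmap d (f q))
        (Der (cmap d \<circ> f \<circ> cinv c2) (cmap c2 q) (Der (cmap c2 \<circ> cinv c) (cmap c q) v))))
      (at (cmap c q))"
      using Der_works[OF t'] e by simp
  qed
  finally show ?thesis by simp
qed

lemma Der_transition_self:
  assumes "smooth_manifold A" "c \<in> A" "q \<in> cdom c"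
  shows "Der (cmap c \<circ> cinv c) (cmap c q) v = v"
proof -
  have "Der (cmap c \<circ> cinv c) (cmap c q) = Der (\<lambda>z. z) (cmap c q)"
    by (rule Der_cong[OF chart_open(2)[OF assms(1,2)]]) (use assms cinv_cmap[OF assms(1,2)] in auto)
  then show ?thesis by simp
qed

lemma Der_transition_compose:
  assumes sm: "smooth_manifold A" and c: "c \<in> A" "d \<in> A" "e \<in> A"
    and q: "q \<in> cdom c" "q \<in> cdom d" "q \<in> cdom e"
  shows "Der (cmap e \<circ> cinv d) (cmap d q) (Der (cmap d \<circ> cinv c) (cmap c q) v) =
    Der (cmap e \<circ> cinv c) (cmap c q) v"
  using Der_change_charts[OF sm sm smooth_map_id[OF sm] c(1) c(1) q(1) q(1) c(2) c(3) q(2) q(3), of v]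
  by (simp add: Der_transition_self[OF sm c(1) q(1), unfolded o_def] o_def)

lemma transition_differentiable:
  assumes "smooth_manifold A" "c \<in> A" "d \<in> A" "q \<in> cdom c" "q \<in> cdom d"
  shows "(cmap d \<circ> cinv c) differentiable (at (cmap c q))"
  by (rule smooth_on_differentiable[of "cmap c ` (cdom c \<inter> cdom d)"])
      (use assms in \<open>auto simp: smooth_manifold_def\<close>)

text \<open>The vector field on the domain of \<open>c\<close> with constant components \<open>w\<close>.\<close>

definition chart_field ::
  "('a, 'e::euclidean_space) chart set \<Rightarrow> ('a, 'e) chart \<Rightarrow> 'e \<Rightarrow> 'a \<Rightarrow> 'e" where
  "chart_field A c w q = Der (cmap (chart_at A q) \<circ> cinv c) (cmap c q) w"

context
  fixes A :: "('a::{t2_space, second_countable_topology}, 'e::euclidean_space) chart set"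
  assumes sm: "smooth_manifold A"
begin

lemma components_chart_field:
  assumes "c \<in> A" "q \<in> cdom c" "d \<in> A" "q \<in> cdom d"
  shows "components A d q (chart_field A c w q) = Der (cmap d \<circ> cinv c) (cmap c q) w"
  unfolding components_def chart_field_def
  using Der_transition_compose[OF sm] chart_atD[OF sm] assms by blast

lemma components_self: "components A (chart_at A p) p u = u"
  unfolding components_def using Der_transition_self[OF sm chart_atD[OF sm]] .

lemma chart_field_self: "chart_field A (chart_at A p) w p = w"
  unfolding chart_field_def using Der_transition_self[OF sm chart_atD[OF sm]] .

lemma linear_chart_field: "c \<in> A \<Longrightarrow> q \<in> cdom c \<Longrightarrow> linear (\<lambda>w. chart_field A c w q)"
  unfolding chart_field_def
  using linear_frechet_derivative[OF transition_differentiable[OF sm _ chart_atD(1)[OF sm] _ chart_atD(2)[OF sm]]]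
  by simp

lemma linear_components: "c \<in> A \<Longrightarrow> q \<in> cdom c \<Longrightarrow> linear (components A c q)"
  using linear_frechet_derivative[OF transition_differentiable[OF sm chart_atD(1)[OF sm] _ chart_atD(2)[OF sm]]]
  by (simp add: components_def[abs_def])

lemma vector_field_chart_field:
  assumes "c \<in> A"
  shows "vector_field A (cdom c) (chart_field A c w)"
  unfolding vector_field_def
proof
  fix d assume d: "d \<in> A"
  let ?S = "cmap d ` (cdom d \<inter> cdom c)" and ?T = "cmap c ` (cdom c \<inter> cdom d)"
  have o: "open ?S" "open ?T" using chart_open_image[OF sm] chart_open[OF sm] assms d by auto
  note inv = cinv_cmap[OF sm d] cinv_cmap[OF sm assms]
  have "smooth_on ?S (\<lambda>z. Der (cmap d \<circ> cinv c) ((cmap c \<circ> cinv d) z) w)"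
  proof (rule smooth_on_compose[where f = "cmap c \<circ> cinv d", OF _ _ o])
    show "smooth_on ?S (cmap c \<circ> cinv d)" using sm assms d by (auto simp: smooth_manifold_def)
    show "smooth_on ?T (\<lambda>y. Der (cmap d \<circ> cinv c) y w)"
      using sm assms d by (intro smooth_on_Der) (auto simp: smooth_manifold_def)
  qed (use inv in auto)
  then show "smooth_on ?S (local_rep A d (chart_field A c w))"
    by (rule smooth_on_cong[OF _ o(1)])
      (use components_chart_field[OF assms _ d] inv in \<open>auto simp: local_rep_def\<close>)
qed

lemma vector_field_subset: "vector_field A W X \<Longrightarrow> V \<subseteq> W \<Longrightarrow> vector_field A V X"
  unfolding vector_field_def by (meson Int_mono image_mono order_refl smooth_on_subset)

lemma smooth_fun_differentiable:
  assumes "smooth_fun A W f" "p \<in> W" "c \<in> A" "p \<in> cdom c"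
  shows "(f \<circ> cinv c) differentiable (at (cmap c p))"
  by (rule smooth_on_differentiable[of "cmap c ` (cdom c \<inter> W)"])
    (use assms in \<open>auto simp: smooth_fun_def\<close>)

lemma local_rep_differentiable:
  assumes "vector_field A W X" "p \<in> W" "c \<in> A" "p \<in> cdom c"
  shows "local_rep A c X differentiable (at (cmap c p))"
  by (rule smooth_on_differentiable[of "cmap c ` (cdom c \<inter> W)"])
    (use assms in \<open>auto simp: vector_field_def\<close>)

lemma local_rep_at: "local_rep A (chart_at A p) X (cmap (chart_at A p) p) = X p"
  by (simp add: local_rep_def cinv_cmap[OF sm chart_atD[OF sm]] components_self)

lemma dir_deriv_const [simp]: "dir_deriv A X (\<lambda>q. k) p = 0"
  by (simp add: dir_deriv_def o_def)

lemma dir_deriv_add: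
  assumes "smooth_fun A W f" "smooth_fun A W h" "p \<in> W"
  shows "dir_deriv A X (\<lambda>q. f q + h q) p = dir_deriv A X f p + dir_deriv A X h p"
  using Der_eq[OF has_derivative_add[OF
        Der_works[OF smooth_fun_differentiable[OF assms(1,3) chart_atD[OF sm]]]
        Der_works[OF smooth_fun_differentiable[OF assms(2,3) chart_atD[OF sm]]]]]
  by (simp add: dir_deriv_def o_def)

end

section \<open>Bilinear forms pulled back along a smooth map\<close>

definition smooth_bilinear ::
  "('a::topological_space, 'e::euclidean_space) chart set \<Rightarrow> ('a \<Rightarrow> 'e \<Rightarrow> 'e \<Rightarrow> real) \<Rightarrow> bool" where
  "smooth_bilinear A T \<longleftrightarrow> (\<forall>p. bilinear (T p)) \<and>
     (\<forall>W X Y. open W \<and> vector_field A W X \<and> vector_field A W Y \<longrightarrow>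
        smooth_fun A W (\<lambda>p. T p (X p) (Y p)))"

definition pullback ::
  "('a, 'e::euclidean_space) chart set \<Rightarrow> ('b, 'f::euclidean_space) chart set \<Rightarrow> ('a \<Rightarrow> 'b) \<Rightarrow>
   ('b \<Rightarrow> 'f \<Rightarrow> 'f \<Rightarrow> real) \<Rightarrow> 'a \<Rightarrow> 'e \<Rightarrow> 'e \<Rightarrow> real" where
  "pullback A A' f T p u v = T (f p) (push A A' f p u) (push A A' f p v)"

lemma bilinear_expansion:
  fixes L :: "'f::euclidean_space \<Rightarrow> 'c::real_vector"
  assumes "bilinear T" "linear L"
  shows "T (L v) (L w) = (\<Sum>i\<in>Basis. \<Sum>j\<in>Basis. T (L i) (L j) * (v \<bullet> i) * (w \<bullet> j) :: real)"
proof -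
  have "T (L v) (L w) = T (\<Sum>i\<in>Basis. (v \<bullet> i) *\<^sub>R L i) (\<Sum>j\<in>Basis. (w \<bullet> j) *\<^sub>R L j)"
    using linear_expansion[OF assms(2)] by metis
  also have "\<dots> = (\<Sum>i\<in>Basis. \<Sum>j\<in>Basis. T ((v \<bullet> i) *\<^sub>R L i) ((w \<bullet> j) *\<^sub>R L j))"
    using bilinear_sum[OF assms(1)] by (simp add: sum.cartesian_product)
  also have "\<dots> = (\<Sum>i\<in>Basis. \<Sum>j\<in>Basis. T (L i) (L j) * (v \<bullet> i) * (w \<bullet> j))"
    by (simp add: bilinear_lmul[OF assms(1)] bilinear_rmul[OF assms(1)] mult.commute mult.left_commute)
  finally show ?thesis .
qed

context
  fixes A :: "('a::{t2_space, second_countable_topology}, 'e::euclidean_space) chart set"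
    and A' :: "('b::{t2_space, second_countable_topology}, 'f::euclidean_space) chart set"
    and f :: "'a \<Rightarrow> 'b" and T :: "'b \<Rightarrow> 'f \<Rightarrow> 'f \<Rightarrow> real"
  assumes sm: "smooth_manifold A" "smooth_manifold A'" and f: "smooth_map A A' f"
begin

lemma push_in_charts:
  assumes "c \<in> A" "q \<in> cdom c" "d \<in> A'" "f q \<in> cdom d"
  shows "push A A' f q u =
    chart_field A' d (Der (cmap d \<circ> f \<circ> cinv c) (cmap c q) (components A c q u)) (f q)"
  unfolding push_def chart_field_def components_def
  by (rule Der_change_charts[OF sm f]) (use assms chart_atD sm in auto)

lemma linear_push: "linear (push A A' f q)"
proof -
  have "(cmap (chart_at A' (f q)) \<circ> f \<circ> cinv (chart_at A q)) differentiable
      (at (cmap (chart_at A q) q))"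
    by (rule smooth_on_differentiable[of "cmap (chart_at A q) ` (cdom (chart_at A q) \<inter>
        f -` cdom (chart_at A' (f q)))"])
      (use f chart_atD[OF sm(1)] chart_atD[OF sm(2)] in \<open>auto simp: smooth_map_def\<close>)
  then show ?thesis using linear_frechet_derivative by (simp add: push_def[abs_def])
qed

text \<open>When \<open>f\<close> is a submersion and \<open>U\<close> is vertical at \<open>p\<close>, this identity contains the
  geometry of the fibres: for a symmetric \<open>T\<close> it compares with the Koszul formula, for a
  skew-symmetric \<open>T\<close> it says that the exterior derivative of the pulled back form vanishes on
  \<open>X, Y, U\<close>.  In coordinates it is the product rule together with
  \<open>f\<^sub>*[X,U] = X(f\<^sub>*U) - U(f\<^sub>*X)\<close>.\<close>

lemma pullback_identity:
  assumes T: "smooth_bilinear A' T"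
    and W: "open W" "p \<in> W" "vector_field A W X" "vector_field A W Y" "vector_field A W U"
    and U: "push A A' f p (U p) = 0"
  shows "dir_deriv A U (\<lambda>q. pullback A A' f T q (X q) (Y q)) p
      + pullback A A' f T p (lie_bracket A X U p) (Y p)
      + pullback A A' f T p (X p) (lie_bracket A Y U p)
    = dir_deriv A X (\<lambda>q. pullback A A' f T q (U q) (Y q)) p
      + dir_deriv A Y (\<lambda>q. pullback A A' f T q (X q) (U q)) p" (is ?I)
    and "((\<lambda>q. pullback A A' f T q (X q) (Y q)) \<circ> cinv (chart_at A p)) differentiable
      (at (cmap (chart_at A p) p))" (is ?D)
proof -
  define c where "c = chart_at A p"
  define d where "d = chart_at A' (f p)"
  have c: "c \<in> A" "p \<in> cdom c" and d: "d \<in> A'" "f p \<in> cdom d"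
    using chart_atD sm by (auto simp: c_def d_def)
  note inv = cinv_cmap[OF sm(1) c(1)]
  define z where "z = cmap c p"
  define F where "F = cmap d \<circ> f \<circ> cinv c"
  define V where "V = f -` cdom d"
  have V: "open V" using f chart_open[OF sm(2) d(1)]
    unfolding V_def smooth_map_def by (simp add: continuous_on_open_vimage)
  define N where "N = cmap c ` (cdom c \<inter> V)"
  have N: "open N" "z \<in> N" using c d V chart_open_image[OF sm(1) c(1)]
    by (auto simp: N_def z_def V_def)
  have F: "smooth_on N F" using f c d by (simp add: smooth_map_def N_def F_def V_def)
  have Fz: "F z = cmap d (f p)" using inv c by (simp add: F_def z_def)
  \<comment> \<open>The coefficients of \<open>T\<close> in the chart \<open>d\<close>; \<open>H\<close> are their pullbacks, \<open>img X\<close> is \<open>f\<^sub>*X\<close> in charts.\<close>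
  define K where "K = (\<lambda>i j y. T (cinv d y) (chart_field A' d i (cinv d y)) (chart_field A' d j (cinv d y)))"
  define H where "H = (\<lambda>i j y. K i j (F y))"
  have K: "K i j differentiable (at (F z))" for i j
  proof -
    have "smooth_fun A' (cdom d) (\<lambda>q. T q (chart_field A' d i q) (chart_field A' d j q))"
      using T vector_field_chart_field[OF sm(2) d(1)] chart_open[OF sm(2) d(1)]
      unfolding smooth_bilinear_def by blast
    from smooth_fun_differentiable[OF sm(2) this d(2) d]
    show ?thesis by (simp add: K_def o_def Fz)
  qed
  have HD: "(H i j has_derivative (\<lambda>v. Der (K i j) (F z) (Der F z v))) (at z)" for i j
    unfolding H_def
    by (rule has_derivative_compose[OF Der_works[OF smooth_on_differentiable[OF F N(2)]] Der_works[OF K]])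
  define img where "img = (\<lambda>X y. Der F y (local_rep A c X y))"
  have push: "push A A' f q (X q) = chart_field A' d (img X (cmap c q)) (f q)"
    if "q \<in> cdom c \<inter> V" for X q
    using push_in_charts[OF c(1) _ d(1), of q "X q"] that inv
    by (simp add: img_def local_rep_def F_def V_def)
  have pb: "pullback A A' f T (cinv c y) (X (cinv c y)) (Y (cinv c y)) =
      (\<Sum>i\<in>Basis. \<Sum>j\<in>Basis. H i j y * (img X y \<bullet> i) * (img Y y \<bullet> j))" if y: "y \<in> N" for X Y y
  proof -
    obtain q where q: "q \<in> cdom c \<inter> V" "y = cmap c q" using y unfolding N_def by blast
    then have fq: "f q \<in> cdom d" "cinv c y = q" "cinv d (F y) = f q"
      using inv cinv_cmap[OF sm(2) d(1)] by (auto simp: V_def F_def)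
    have "bilinear (T (f q))" using T by (simp add: smooth_bilinear_def)
    from bilinear_expansion[OF this linear_chart_field[OF sm(2) d(1) fq(1)], of "img X y" "img Y y"]
    show ?thesis
      unfolding pullback_def H_def K_def fq(2,3) push[OF q(1), of X] push[OF q(1), of Y] q(2)[symmetric] .
  qed
  have rep: "local_rep A c X differentiable (at z)" "local_rep A c X z = X p"
    if "vector_field A W X" for X
    using local_rep_differentiable[OF sm(1) that W(2) c] local_rep_at[OF sm(1)]
    by (simp_all add: z_def c_def)
  have imgD: "img X differentiable (at z)" if "vector_field A W X" for X
    using has_derivative_Der_field[OF F N rep(1)[OF that]] by (auto simp: img_def differentiable_def)
  have pv: "push A A' f p v = chart_field A' d (Der F z v) (f p)" for v
    using push_in_charts[OF c(1,2) d, of v] components_self[OF sm(1)] by (simp add: F_def z_def c_def)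
  have push0: "Der F z v = 0 \<longleftrightarrow> push A A' f p v = 0" for v
  proof
    have "linear (components A' d (f p))" "linear (\<lambda>w. chart_field A' d w (f p))"
      by (fact linear_components[OF sm(2) d] linear_chart_field[OF sm(2) d])+
    then show "push A A' f p v = 0" if "Der F z v = 0"
      using that by (simp add: pv linear_0[of "\<lambda>w. chart_field A' d w (f p)"])
    show "Der F z v = 0" if "push A A' f p v = 0"
      using components_chart_field[OF sm(2) d d, of "Der F z v"] that linear_0[OF linear_components[OF sm(2) d]]
      by (simp add: pv Der_transition_self[OF sm(2) d])
  qed
  have k0: "img U z = 0" using push0 U rep(2)[OF W(5)] by (simp add: img_def)
  \<comment> \<open>\<open>U\<close> is vertical at \<open>p\<close>, so functions pulled back from the target are stationary along it.\<close>
  have Du: "Der (H i j) z (U p) = 0" for i j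
    unfolding Der_eq[OF HD] using k0 rep(2)[OF W(5)] linear_0[OF linear_frechet_derivative[OF K]]
    by (simp add: img_def)
  have Hd: "H i j differentiable (at z)" for i j using HD by (auto simp: differentiable_def)
  define Q where "Q = (\<lambda>y v w. \<Sum>i\<in>Basis. \<Sum>j\<in>Basis. H i j y * (v \<bullet> i) * (w \<bullet> j))"
  have dd: "dir_deriv A Z (\<lambda>q. pullback A A' f T q (X q) (Y q)) p =
      Der (\<lambda>y. Q y (img X y) (img Y y)) z (Z p)" for X Y Z
    unfolding dir_deriv_def c_def[symmetric] z_def[symmetric]
    by (rule fun_cong[OF Der_cong[OF N]]) (simp add: pb Q_def)
  have br: "Der F z (lie_bracket A X U p) = Der (img U) z (X p) - Der (img X) z (U p)"
    if "vector_field A W X" for X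
    using Der_bracket[OF F N rep(1)[OF that] rep(1)[OF W(5)]] rep(2)[OF that] rep(2)[OF W(5)]
    by (simp add: lie_bracket_def c_def[symmetric] z_def[symmetric] img_def)
  have ptw: "pullback A A' f T p v w = Q z (Der F z v) (Der F z w)" for v w
  proof -
    have "bilinear (T (f p))" using T by (simp add: smooth_bilinear_def)
    from bilinear_expansion[OF this linear_chart_field[OF sm(2) d], of "Der F z v" "Der F z w"]
    show ?thesis
      unfolding pullback_def pv Q_def H_def K_def Fz cinv_cmap[OF sm(2) d] .
  qed
  have at_z: "Der F z (X p) = img X z" if "vector_field A W X" for X
    using rep(2)[OF that] by (simp add: img_def)
  note id = product_rule_identity[OF imgD[OF W(3)] imgD[OF W(4)] imgD[OF W(5)] k0 Hd Du]
  show ?I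
    unfolding dd ptw br[OF W(3)] br[OF W(4)] at_z[OF W(3)] at_z[OF W(4)]
    unfolding Q_def by (rule id(1))
  have "((\<lambda>q. pullback A A' f T q (X q) (Y q)) \<circ> cinv c) differentiable (at z)"
    by (rule differentiable_cong_open[OF N _ id(2)]) (simp add: pb Q_def)
  then show ?D by (simp add: c_def z_def)
qed

end

section \<open>Orthogonal splittings\<close>

text \<open>One step of the Gram-Schmidt process for the inner product \<open>G\<close>: the new generator \<open>a\<close> is replaced by
  its component \<open>a1\<close> orthogonal to the span of the earlier ones.\<close>

lemma orthogonal_splitting_span:
  fixes G :: "'e::real_vector \<Rightarrow> 'e \<Rightarrow> real"
  assumes G: "bilinear G" "\<And>u v. G u v = G v u" "\<And>u. u \<noteq> 0 \<Longrightarrow> G u u > 0"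
    and "finite S"
  shows "\<exists>v\<in>span S. \<forall>w\<in>span S. G (u - v) w = 0"
  using \<open>finite S\<close>
proof (induction S arbitrary: u rule: finite_induct)
  case empty
  then show ?case using bilinear_rzero[OF G(1)] by auto
next
  case (insert a S)
  note bl = bilinear_ladd[OF G(1)] bilinear_lsub[OF G(1)] bilinear_lmul[OF G(1)]
    bilinear_radd[OF G(1)] bilinear_rsub[OF G(1)] bilinear_rmul[OF G(1)]
  obtain a0 where a0: "a0 \<in> span S" "\<And>w. w \<in> span S \<Longrightarrow> G (a - a0) w = 0"
    using insert.IH[of a] by blast
  obtain v0 where v0: "v0 \<in> span S" "\<And>w. w \<in> span S \<Longrightarrow> G (u - v0) w = 0"
    using insert.IH[of u] by blast
  define a1 where "a1 = a - a0"
  \<comment> \<open>For \<open>a1 = 0\<close> the quotient is 0, and the correction term \<open>t *\<^sub>R a1\<close> vanishes as it should.\<close>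
  define t where "t = G u a1 / G a1 a1"
  define v where "v = v0 + t *\<^sub>R a1"
  have v: "v \<in> span (insert a S)"
  proof -
    have "v0 \<in> span (insert a S)" "a0 \<in> span (insert a S)"
      using v0(1) a0(1) span_mono[of S "insert a S"] by auto
    then show ?thesis unfolding v_def a1_def
      by (intro span_add span_scale span_diff) (auto intro: span_base)
  qed
  have S0: "G (u - v) w = 0" if "w \<in> span S" for w
    using v0(2)[OF that] a0(2)[OF that] by (simp add: v_def a1_def bl)
  have a1_0: "G (u - v) a1 = 0"
  proof (cases "a1 = 0")
    case True
    then show ?thesis using bilinear_rzero[OF G(1)] by simp
  next
    case False
    have "G v0 a1 = 0" using a0(2)[OF v0(1)] G(2)[of v0 a1] by (simp add: a1_def)
    then show ?thesis using G(3)[OF False] by (simp add: v_def t_def bl)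
  qed
  have "G (u - v) w = 0" if w: "w \<in> span (insert a S)" for w
  proof -
    obtain k where k: "w - k *\<^sub>R a \<in> span S" using w by (auto simp: span_insert)
    have "w = (w - k *\<^sub>R a) + k *\<^sub>R a0 + k *\<^sub>R a1" by (simp add: a1_def algebra_simps)
    then have "G (u - v) w = G (u - v) (w - k *\<^sub>R a) + k * G (u - v) a0 + k * G (u - v) a1"
      by (metis bilinear_radd[OF G(1)] bilinear_rmul[OF G(1)] real_scaleR_def)
    then show ?thesis using S0[OF k] S0[OF a0(1)] a1_0 by simp
  qed
  then show ?case using v by blast
qed

lemma orthogonal_splitting:
  fixes G :: "'e::euclidean_space \<Rightarrow> 'e \<Rightarrow> real"
  assumes G: "bilinear G" "\<And>u v. G u v = G v u" "\<And>u. u \<noteq> 0 \<Longrightarrow> G u u > 0"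
    and V: "subspace V"
  shows "\<exists>v\<in>V. \<forall>w\<in>V. G (u - v) w = 0"
proof -
  obtain S where "finite S" "span S = V"
    using finiteI_independent basis_exists[of V] V by (metis span_subspace)
  then show ?thesis using orthogonal_splitting_span[OF G, of S u] by blast
qed

section \<open>Contact-complex submersions\<close>

locale contact_submersion =
  fixes \<A> :: "('a::{t2_space, second_countable_topology}, 'e::euclidean_space) chart set"
    and \<phi> :: "'a \<Rightarrow> 'e \<Rightarrow> 'e" and \<xi> :: "'a \<Rightarrow> 'e" and \<eta> :: "'a \<Rightarrow> 'e \<Rightarrow> real"
    and g :: "'a \<Rightarrow> 'e \<Rightarrow> 'e \<Rightarrow> real"
    and \<A>' :: "('b::{t2_space, second_countable_topology}, 'f::euclidean_space) chart set"
    and J :: "'b \<Rightarrow> 'f \<Rightarrow> 'f" and g' :: "'b \<Rightarrow> 'f \<Rightarrow> 'f \<Rightarrow> real"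
    and \<pi> :: "'a \<Rightarrow> 'b"
    and D :: "('a \<Rightarrow> 'e) \<Rightarrow> ('a \<Rightarrow> 'e) \<Rightarrow> 'a \<Rightarrow> 'e"
  assumes subm: "contact_complex_submersion \<A> \<phi> \<xi> \<eta> g \<A>' J g' \<pi>"
    and LC: "levi_civita \<A> g D"
begin

abbreviation "\<Phi> \<equiv> fund_form g \<phi>"
abbreviation "V \<equiv> vert \<A> \<A>' \<pi>"
abbreviation "H \<equiv> horiz \<A> \<A>' g \<pi>"
abbreviation "P \<equiv> push \<A> \<A>' \<pi>"
abbreviation "vp \<equiv> vproj \<A> \<A>' g \<pi>"
abbreviation "hp \<equiv> hproj \<A> \<A>' g \<pi>"

lemma acm: "acm_manifold \<A> \<phi> \<xi> \<eta> g"
  and ahm: "almost_hermitian_manifold \<A>' J g'"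
  and rsub: "riemannian_submersion \<A> g \<A>' g' \<pi>"
  and P_\<phi>: "P p (\<phi> p u) = J (\<pi> p) (P p u)"
  using subm by (auto simp: contact_complex_submersion_def)

lemma sm: "smooth_manifold \<A>" "smooth_manifold \<A>'"
  and metric: "riemannian_metric \<A> g" and metric': "riemannian_metric \<A>' g'"
  and tensor_\<phi>: "tensor11 \<A> \<phi>" and tensor_J: "tensor11 \<A>' J"
  and \<xi>_field: "vector_field \<A> UNIV \<xi>" and \<eta>_form: "one_form \<A> \<eta>"
  and \<phi>\<phi>: "\<phi> p (\<phi> p u) = - u + \<eta> p u *\<^sub>R \<xi> p"
  and \<eta>_\<xi>: "\<eta> p (\<xi> p) = 1"
  and g_\<phi>\<phi>: "g p (\<phi> p u) (\<phi> p v) = g p u v - \<eta> p u * \<eta> p v"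
  and JJ: "J y (J y w) = - w"
  using acm ahm by (auto simp: acm_manifold_def almost_hermitian_manifold_def)

lemma smooth_\<pi>: "smooth_map \<A> \<A>' \<pi>" and surj_P: "surj (P p)"
  and isometry: "u \<in> H p \<Longrightarrow> v \<in> H p \<Longrightarrow> g' (\<pi> p) (P p u) (P p v) = g p u v"
  using rsub by (auto simp: riemannian_submersion_def)

lemma bil: "bilinear (g p)" and g_commute: "g p u v = g p v u"
  and g_pos: "u \<noteq> 0 \<Longrightarrow> g p u u > 0"
  and bil': "bilinear (g' y)" and g'_commute: "g' y w z = g' y z w"
  using metric metric' by (auto simp: riemannian_metric_def)

lemmas g_simps = bilinear_ladd[OF bil] bilinear_radd[OF bil] bilinear_lsub[OF bil]
  bilinear_rsub[OF bil] bilinear_lmul[OF bil, simplified] bilinear_rmul[OF bil, simplified]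
  bilinear_lzero[OF bil] bilinear_rzero[OF bil] bilinear_lneg[OF bil, simplified]
  bilinear_rneg[OF bil, simplified]

lemma linear_\<phi>: "linear (\<phi> p)" and linear_\<eta>: "linear (\<eta> p)" and linear_J: "linear (J y)"
  using tensor_\<phi> \<eta>_form tensor_J by (auto simp: tensor11_def one_form_def)

lemmas \<phi>_simps = linear_add[OF linear_\<phi>] linear_diff[OF linear_\<phi>] linear_scale[OF linear_\<phi>]
  linear_0[OF linear_\<phi>] linear_neg[OF linear_\<phi>]
lemmas \<eta>_simps = linear_add[OF linear_\<eta>] linear_diff[OF linear_\<eta>] linear_scale[OF linear_\<eta>]
  linear_0[OF linear_\<eta>] linear_neg[OF linear_\<eta>]
lemmas linear_P = linear_push[OF sm smooth_\<pi>]
lemmas P_simps = linear_add[OF linear_P] linear_diff[OF linear_P] linear_scale[OF linear_P]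
  linear_0[OF linear_P] linear_neg[OF linear_P]

lemma \<phi>_\<xi>: "\<phi> p (\<xi> p) = 0"
proof -
  have "\<phi> p (\<phi> p (\<xi> p)) = 0" by (simp add: \<phi>\<phi> \<eta>_\<xi>)
  moreover from this have "\<phi> p (\<xi> p) = \<eta> p (\<phi> p (\<xi> p)) *\<^sub>R \<xi> p"
    using \<phi>\<phi>[of p "\<phi> p (\<xi> p)"] by (simp add: \<phi>_simps)
  ultimately have "\<eta> p (\<phi> p (\<xi> p)) *\<^sub>R \<phi> p (\<xi> p) = 0" by (metis \<phi>_simps(3))
  then show ?thesis using \<open>\<phi> p (\<xi> p) = _\<close> by (metis scaleR_eq_0_iff)
qed

lemma \<eta>_\<phi>: "\<eta> p (\<phi> p u) = 0"
proof -
  have "\<phi> p (\<phi> p (\<phi> p u)) = - \<phi> p u"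
    by (subst \<phi>\<phi>[of p u]) (simp add: \<phi>_simps \<phi>_\<xi>)
  then have "\<eta> p (\<phi> p u) *\<^sub>R \<xi> p = 0" using \<phi>\<phi>[of p "\<phi> p u"] by simp
  moreover have "\<xi> p \<noteq> 0" using \<eta>_\<xi>[of p] by (auto simp: \<eta>_simps)
  ultimately show ?thesis by simp
qed

lemma \<eta>_eq: "\<eta> p u = g p u (\<xi> p)"
  using g_\<phi>\<phi>[of p u "\<xi> p"] by (simp add: \<phi>_\<xi> \<eta>_\<xi> g_simps)

lemma g_\<phi>_skew: "g p (\<phi> p u) v = - g p u (\<phi> p v)"
  using g_\<phi>\<phi>[of p "\<phi> p u" v] by (simp add: \<phi>\<phi> \<eta>_\<phi> g_simps g_commute[of p "\<xi> p"] \<eta>_eq[symmetric])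

lemma \<Phi>_skew: "\<Phi> p u v = - \<Phi> p v u"
  by (simp add: fund_form_def g_\<phi>_skew[symmetric] g_commute)

lemma in_V: "u \<in> V p \<longleftrightarrow> P p u = 0" by (simp add: vert_def)

lemma in_H: "u \<in> H p \<longleftrightarrow> (\<forall>v\<in>V p. g p u v = 0)" by (simp add: horiz_def)

lemma g_H_V: "x \<in> H p \<Longrightarrow> u \<in> V p \<Longrightarrow> g p x u = 0" "x \<in> H p \<Longrightarrow> u \<in> V p \<Longrightarrow> g p u x = 0"
  by (auto simp: in_H g_commute)

lemma subspace_V: "subspace (V p)"
  by (auto simp: subspace_def in_V P_simps)

lemma V_combine: "u \<in> V p \<Longrightarrow> v \<in> V p \<Longrightarrow> u - v \<in> V p" "u \<in> V p \<Longrightarrow> v \<in> V p \<Longrightarrow> u + v \<in> V p"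
    "u \<in> V p \<Longrightarrow> k *\<^sub>R u \<in> V p"
  by (simp_all add: in_V P_simps)

lemma H_combine: "u \<in> H p \<Longrightarrow> v \<in> H p \<Longrightarrow> u - v \<in> H p" "u \<in> H p \<Longrightarrow> v \<in> H p \<Longrightarrow> u + v \<in> H p"
    "u \<in> H p \<Longrightarrow> k *\<^sub>R u \<in> H p"
  by (simp_all add: in_H g_simps)

lemma V_Int_H: "u \<in> V p \<Longrightarrow> u \<in> H p \<Longrightarrow> u = 0"
  using g_pos[of u p] by (metis in_H less_irrefl)

lemma \<xi>_V: "\<xi> p \<in> V p"
proof -
  have "J (\<pi> p) (P p (\<xi> p)) = 0" using P_\<phi>[of p "\<xi> p"] by (simp add: \<phi>_\<xi> P_simps)
  then show ?thesis using JJ[of "\<pi> p" "P p (\<xi> p)"] by (simp add: in_V linear_0[OF linear_J])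
qed

lemma \<phi>_V: "u \<in> V p \<Longrightarrow> \<phi> p u \<in> V p"
  by (simp add: in_V P_\<phi> linear_0[OF linear_J])

lemma \<phi>_H: "x \<in> H p \<Longrightarrow> \<phi> p x \<in> H p"
  using \<phi>_V by (simp add: in_H g_\<phi>_skew)

lemma \<eta>_H: "x \<in> H p \<Longrightarrow> \<eta> p x = 0"
  using \<xi>_V by (simp add: \<eta>_eq in_H)

lemma splitting: "\<exists>!v. v \<in> V p \<and> u - v \<in> H p"
proof -
  have "\<exists>v\<in>V p. \<forall>w\<in>V p. g p (u - v) w = 0"
    by (rule orthogonal_splitting[OF bil g_commute g_pos subspace_V])
  then obtain v where "v \<in> V p" "u - v \<in> H p" by (auto simp: in_H)
  moreover have "w = v" if "w \<in> V p" "u - w \<in> H p" for w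
  proof -
    have "w - v \<in> V p" using V_combine that \<open>v \<in> V p\<close> by blast
    moreover have "w - v \<in> H p" using H_combine(1)[OF \<open>u - v \<in> H p\<close> that(2)] by simp
    ultimately show ?thesis using V_Int_H by force
  qed
  ultimately show ?thesis by blast
qed

lemma vp: "vp p u \<in> V p" "u - vp p u \<in> H p"
  using theI'[OF splitting[of p u]] by (simp_all add: vproj_def)

lemma vp_unique: "v \<in> V p \<Longrightarrow> u - v \<in> H p \<Longrightarrow> vp p u = v"
  using splitting vp by blast

lemma hp_eq: "hp p u = u - vp p u"
  unfolding hproj_def
proof (rule the_equality)
  show "w = u - vp p u" if "w \<in> H p \<and> u - w \<in> V p" for w
    using vp_unique[of "u - w" p u] that by simp
qed (use vp in simp)

lemma hp: "hp p u \<in> H p" "u - hp p u \<in> V p"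
  using vp by (simp_all add: hp_eq)

lemma vp_V: "u \<in> V p \<Longrightarrow> vp p u = u"
  by (rule vp_unique) (simp_all add: in_H g_simps)

lemma vp_H: "u \<in> H p \<Longrightarrow> vp p u = 0"
  by (rule vp_unique) (simp_all add: in_V P_simps)

lemma vp_0: "vp p 0 = 0"
  by (rule vp_V) (simp add: in_V P_simps)

lemma g_vp: "w \<in> V p \<Longrightarrow> g p (vp p u) w = g p u w"
  using g_H_V(1)[OF vp(2), of w p u] by (simp add: g_simps)

lemma g_hp: "x \<in> H p \<Longrightarrow> g p (hp p u) x = g p u x"
  using g_H_V(2)[OF _ vp(1), of x p u] by (simp add: hp_eq g_simps)

lemma V_eqI:
  assumes "u \<in> V p" "v \<in> V p" "\<And>w. w \<in> V p \<Longrightarrow> g p u w = g p v w"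
  shows "u = v"
proof -
  have "u - v \<in> V p" using V_combine(1)[OF assms(1,2)] .
  moreover have "u - v \<in> H p" using assms(3) by (simp add: in_H g_simps)
  ultimately show ?thesis using V_Int_H by force
qed

lemma H_eqI:
  assumes "u \<in> H p" "v \<in> H p" "\<And>x. x \<in> H p \<Longrightarrow> g p u x = g p v x"
  shows "u = v"
proof -
  have "u - v \<in> H p" using H_combine(1)[OF assms(1,2)] .
  moreover from this have "g p (u - v) (u - v) = 0" using assms(3)[of "u - v"] by (simp add: g_simps)
  ultimately show ?thesis using g_pos[of "u - v" p] by fastforce
qed

section \<open>Metric and fundamental form against pullbacks from the base\<close>

abbreviation "vf \<equiv> vector_field \<A>"

definition "\<beta> \<equiv> pullback \<A> \<A>' \<pi> g'"
definition "\<beta>J \<equiv> pullback \<A> \<A>' \<pi> (\<lambda>y u v. g' y u (J y v))"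

lemma smooth_bilinear_g': "smooth_bilinear \<A>' g'"
  using metric' by (simp add: smooth_bilinear_def riemannian_metric_def)

lemma smooth_bilinear_g'J: "smooth_bilinear \<A>' (\<lambda>y u v. g' y u (J y v))"
  unfolding smooth_bilinear_def
proof (intro conjI allI impI)
  show "bilinear (\<lambda>u v. g' y u (J y v))" for y
    using bil'[of y] linear_compose[OF linear_J, unfolded o_def]
    unfolding bilinear_def by blast
  show "smooth_fun \<A>' W (\<lambda>y. g' y (X y) (J y (Y y)))"
    if "open W \<and> vector_field \<A>' W X \<and> vector_field \<A>' W Y" for W X Y
    using metric' tensor_J that by (auto simp: tensor11_def riemannian_metric_def)
qed

lemma \<beta>_V: "u \<in> V p \<Longrightarrow> \<beta> p u v = 0" "v \<in> V p \<Longrightarrow> \<beta> p u v = 0"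
  by (simp_all add: \<beta>_def pullback_def in_V bilinear_lzero[OF bil'] bilinear_rzero[OF bil'])

lemma \<beta>J_eq: "\<beta>J p u v = \<beta> p u (\<phi> p v)"
  by (simp add: \<beta>J_def \<beta>_def pullback_def P_\<phi>)

lemma \<beta>_commute: "\<beta> p u v = \<beta> p v u"
  by (simp add: \<beta>_def pullback_def g'_commute)

lemma \<beta>_add: "\<beta> p (u + v) w = \<beta> p u w + \<beta> p v w" "\<beta> p w (u + v) = \<beta> p w u + \<beta> p w v"
  by (simp_all add: \<beta>_def pullback_def P_simps bilinear_ladd[OF bil'] bilinear_radd[OF bil'])

text \<open>The vertical part of \<open>u\<close> contributes to neither side, and on horizontal vectors the two tensors
  agree by the isometry property.\<close>

lemma g_H: "x \<in> H p \<Longrightarrow> g p u x = \<beta> p u x" "x \<in> H p \<Longrightarrow> g p x u = \<beta> p x u"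
proof -
  have *: "g p u x = \<beta> p u x" if x: "x \<in> H p" for u
  proof -
    have "g p u x = g p (hp p u) x" using g_hp[OF x] by simp
    also have "\<dots> = \<beta> p (hp p u) x" using isometry[OF hp(1) x] by (simp add: \<beta>_def pullback_def)
    also have "\<dots> = \<beta> p u x"
      using \<beta>_add(1)[of p "hp p u" "u - hp p u" x] \<beta>_V(1)[OF hp(2)] by simp
    finally show ?thesis .
  qed
  show "x \<in> H p \<Longrightarrow> g p u x = \<beta> p u x" using * .
  show "x \<in> H p \<Longrightarrow> g p x u = \<beta> p x u" using * by (metis g_commute \<beta>_commute)
qed

lemma \<Phi>_H: "x \<in> H p \<Longrightarrow> \<Phi> p u x = \<beta>J p u x" "x \<in> H p \<Longrightarrow> \<Phi> p x u = \<beta>J p x u"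
  by (simp_all add: fund_form_def g_H \<phi>_H \<beta>J_eq)

lemma \<beta>J_V: "u \<in> V p \<Longrightarrow> \<beta>J p u v = 0" "v \<in> V p \<Longrightarrow> \<beta>J p u v = 0"
  by (simp_all add: \<beta>J_eq \<beta>_V \<phi>_V)

lemma \<Phi>_H_V: "x \<in> H p \<Longrightarrow> u \<in> V p \<Longrightarrow> \<Phi> p x u = 0" "x \<in> H p \<Longrightarrow> u \<in> V p \<Longrightarrow> \<Phi> p u x = 0"
  by (simp_all add: \<Phi>_H \<beta>J_V)

lemma \<Phi>_\<xi>: "\<Phi> p u (\<xi> p) = 0" "\<Phi> p (\<xi> p) u = 0"
  using \<Phi>_skew[of p "\<xi> p" u] by (simp_all add: fund_form_def \<phi>_\<xi> g_simps)

lemma \<Phi>_\<phi>\<phi>: "\<Phi> p (\<phi> p u) (\<phi> p v) = \<Phi> p u v"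
  by (simp add: fund_form_def g_\<phi>\<phi> \<eta>_\<phi>)

lemmas \<beta>_identity = pullback_identity(1)[OF sm smooth_\<pi> smooth_bilinear_g', folded \<beta>_def]
lemmas \<beta>J_identity = pullback_identity(1)[OF sm smooth_\<pi> smooth_bilinear_g'J, folded \<beta>J_def]

lemma vf_UNIV: "vf UNIV X \<Longrightarrow> vf W X"
  using vector_field_subset[OF sm(1) _ subset_UNIV] .

lemma vf_\<xi>: "vf W \<xi>" using vf_UNIV \<xi>_field .

lemma vf_\<phi>: "open W \<Longrightarrow> vf W X \<Longrightarrow> vf W (\<lambda>q. \<phi> q (X q))"
  using tensor_\<phi> by (auto simp: tensor11_def)

lemma vf_0: "open W \<Longrightarrow> vf W (\<lambda>q. 0)"
  using vf_\<phi>[OF _ vf_\<xi>] by (simp add: \<phi>_\<xi>)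

lemma smooth_\<eta>: "open W \<Longrightarrow> vf W X \<Longrightarrow> smooth_fun \<A> W (\<lambda>q. \<eta> q (X q))"
  using \<eta>_form by (auto simp: one_form_def)

text \<open>The form \<open>g - \<beta>\<close> is the metric on the vertical parts: it is positive semidefinite and
  vanishes on pairs with a horizontal entry.  Hence its derivative at such a pair vanishes, by
  polarisation, because the associated quadratic form has a minimum there.  This handles fields that
  are horizontal at a single point only.\<close>

lemma \<beta>_le_g: "\<beta> p u u \<le> g p u u"
proof -
  have "\<beta> p u u = \<beta> p u (hp p u)"
    using \<beta>_add(1)[of p "hp p u" "u - hp p u" u] \<beta>_V(1)[OF hp(2)] \<beta>_commute[of p u "hp p u"] by simp
  also have "\<dots> = g p u (hp p u)" using g_H(1)[OF hp(1)] by simp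
  also have "\<dots> = g p u u - g p u (vp p u)" by (simp add: hp_eq g_simps)
  also have "\<dots> \<le> g p u u"
  proof -
    have "g p (vp p u) (vp p u) \<ge> 0"
      using g_pos[of "vp p u" p] by (cases "vp p u = 0") (auto simp: g_simps)
    then show ?thesis using g_vp[OF vp(1), of p u u] by (simp add: g_commute)
  qed
  finally show ?thesis .
qed

lemma zero_min_Der:
  fixes f :: "'c::real_normed_vector \<Rightarrow> real"
  assumes "f differentiable (at z)" "f z = 0" "\<And>y. f y \<ge> 0"
  shows "Der f z = (\<lambda>v. 0)"
  by (rule has_derivative_local_min[OF Der_works[OF assms(1)]]) (simp add: assms)

lemma dir_deriv_g_horizontal:
  assumes W: "open W" "p \<in> W" "vf W X" "vf W Y" and XY: "X p \<in> H p" "Y p \<in> H p"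
  shows "dir_deriv \<A> U (\<lambda>q. g q (X q) (Y q)) p = dir_deriv \<A> U (\<lambda>q. \<beta> q (X q) (Y q)) p"
proof -
  define c where "c = chart_at \<A> p"
  define z where "z = cmap c p"
  have inv: "cinv c z = p" using cinv_cmap[OF sm(1) chart_atD[OF sm(1)]] by (simp add: z_def c_def)
  define q where "q = (\<lambda>X Y y. g (cinv c y) (X (cinv c y)) (Y (cinv c y)) - \<beta> (cinv c y) (X (cinv c y)) (Y (cinv c y)))"
  have gd: "((\<lambda>q. g q (X q) (Y q)) \<circ> cinv c) differentiable (at z)" if "vf W X" "vf W Y" for X Y
  proof -
    have "smooth_fun \<A> W (\<lambda>q. g q (X q) (Y q))"
      using metric W(1) that by (auto simp: riemannian_metric_def)
    from smooth_fun_differentiable[OF sm(1) this W(2) chart_atD[OF sm(1)]]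
    show ?thesis by (simp add: c_def z_def)
  qed
  have bd: "((\<lambda>q. \<beta> q (X q) (Y q)) \<circ> cinv c) differentiable (at z)" if "vf W X" "vf W Y" for X Y
    using pullback_identity(2)[OF sm smooth_\<pi> smooth_bilinear_g' W(1,2) that vf_0[OF W(1)]]
    by (simp add: P_simps \<beta>_def c_def z_def)
  have qd: "q X Y differentiable (at z)" if "vf W X" "vf W Y" for X Y
    using differentiable_diff[OF gd[OF that] bd[OF that]] by (simp add: q_def o_def)
  have qz: "q X Y z = 0" if "X p \<in> H p" for X Y using that by (simp add: q_def inv g_H)
  have "q X X y \<ge> 0" for X y using \<beta>_le_g by (simp add: q_def)
  then have q0: "Der (q X X) z = (\<lambda>v. 0)" if "vf W X" "X p \<in> H p" for X
    by (intro zero_min_Der qd qz that)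
  \<comment> \<open>The quadratic form on \<open>X + Y\<close>, which also has a minimum at \<open>p\<close>.\<close>
  have pol: "q X X y + 2 * q X Y y + q Y Y y \<ge> 0" for y
    using \<beta>_le_g[of "cinv c y" "X (cinv c y) + Y (cinv c y)"]
    by (simp add: q_def \<beta>_add g_simps g_commute[of _ "Y _" "X _"] \<beta>_commute[of _ "Y _" "X _"])
  have "((\<lambda>y. q X X y + 2 * q X Y y + q Y Y y) has_derivative
      (\<lambda>v. Der (q X X) z v + 2 * Der (q X Y) z v + Der (q Y Y) z v)) (at z)"
    by (intro has_derivative_add has_derivative_mult_right Der_works qd W)
  from has_derivative_local_min[OF this] pol
  have "(\<lambda>v. Der (q X X) z v + 2 * Der (q X Y) z v + Der (q Y Y) z v) = (\<lambda>v. 0)"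
    by (simp add: qz XY)
  from fun_cong[OF this] have "Der (q X Y) z v = 0" for v
    by (simp add: q0[OF W(3) XY(1)] q0[OF W(4) XY(2)])
  moreover have "Der (q X Y) z v = Der ((\<lambda>q. g q (X q) (Y q)) \<circ> cinv c) z v
      - Der ((\<lambda>q. \<beta> q (X q) (Y q)) \<circ> cinv c) z v" for v
    using Der_eq[OF has_derivative_diff[OF Der_works[OF gd[OF W(3,4)]] Der_works[OF bd[OF W(3,4)]]]]
    by (simp add: q_def o_def)
  ultimately show ?thesis by (simp add: dir_deriv_def c_def z_def)
qed

section \<open>The Levi-Civita connection\<close>

lemma D_rules:
  assumes "open W" "p \<in> W" "vf W X" "vf W Y"
  shows D_add: "vf W Z \<Longrightarrow> D X (\<lambda>q. Y q + Z q) p = D X Y p + D X Z p"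
    and D_scale: "smooth_fun \<A> W f \<Longrightarrow>
      D X (\<lambda>q. f q *\<^sub>R Y q) p = dir_deriv \<A> X f p *\<^sub>R Y p + f p *\<^sub>R D X Y p"
    and torsion: "lie_bracket \<A> X Y p = D X Y p - D Y X p"
    and D_metric: "vf W Z \<Longrightarrow>
      dir_deriv \<A> X (\<lambda>q. g q (Y q) (Z q)) p = g p (D X Y p) (Z p) + g p (Y p) (D X Z p)"
proof -
  have L: "open W \<and> vf W X \<and> vf W Y \<and> vf W Z \<and> smooth_fun \<A> W f \<Longrightarrow>
      D X (\<lambda>q. Y q + Z q) p = D X Y p + D X Z p \<and>
      D X (\<lambda>q. f q *\<^sub>R Y q) p = dir_deriv \<A> X f p *\<^sub>R Y p + f p *\<^sub>R D X Y p \<and>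
      D X Y p - D Y X p = lie_bracket \<A> X Y p \<and>
      dir_deriv \<A> X (\<lambda>q. g q (Y q) (Z q)) p = g p (D X Y p) (Z p) + g p (Y p) (D X Z p)" for Z f
    using LC assms(2) unfolding levi_civita_def by blast
  have s: "smooth_fun \<A> W (\<lambda>q. \<eta> q (\<xi> q))" using smooth_\<eta> assms(1) vf_\<xi> by blast
  show "vf W Z \<Longrightarrow> D X (\<lambda>q. Y q + Z q) p = D X Y p + D X Z p" using L s assms by blast
  show "smooth_fun \<A> W f \<Longrightarrow>
      D X (\<lambda>q. f q *\<^sub>R Y q) p = dir_deriv \<A> X f p *\<^sub>R Y p + f p *\<^sub>R D X Y p" using L assms by blast
  show "lie_bracket \<A> X Y p = D X Y p - D Y X p" using L s assms by metis
  show "vf W Z \<Longrightarrow>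
      dir_deriv \<A> X (\<lambda>q. g q (Y q) (Z q)) p = g p (D X Y p) (Z p) + g p (Y p) (D X Z p)"
    using L s assms by blast
qed

lemma D_zero: "open W \<Longrightarrow> p \<in> W \<Longrightarrow> vf W X \<Longrightarrow> D X (\<lambda>q. 0) p = 0"
  using D_add[of W p X "\<lambda>q. 0" "\<lambda>q. 0"] vf_0 by simp

lemma vf_through: "\<exists>W X. open W \<and> p \<in> W \<and> vf W X \<and> X p = u"
proof (intro exI conjI)
  show "open (cdom (chart_at \<A> p))" by (rule chart_open(1)[OF sm(1) chart_atD(1)[OF sm(1)]])
  show "p \<in> cdom (chart_at \<A> p)" by (rule chart_atD(2)[OF sm(1)])
  show "vf (cdom (chart_at \<A> p)) (chart_field \<A> (chart_at \<A> p) u)"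
    by (rule vector_field_chart_field[OF sm(1) chart_atD(1)[OF sm(1)]])
  show "chart_field \<A> (chart_at \<A> p) u p = u" by (rule chart_field_self[OF sm(1)])
qed

section \<open>Horizontal and vertical derivatives\<close>

text \<open>The right-hand side of the pullback identity for \<open>\<beta>\<close> vanishes when \<open>U\<close> is vertical around the
  point, so \<open>(L\<^sub>U g)(X, Y) = 0\<close>.  Only \<open>X\<close> has to be horizontal around the point; \<open>Y\<close> may be any
  extension of a horizontal vector, which makes the formula a statement about the tensor
  \<open>A\<^sub>XU\<close> tested against all horizontal vectors.\<close>

lemma nabla_vertical_skew:
  assumes W: "open W" "p \<in> W" "vf W X" "vf W Y" "vf W U"
    and X: "\<And>q. X q \<in> H q" and U: "\<And>q. U q \<in> V q" and Y: "Y p \<in> H p"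
  shows "g p (D X U p) (Y p) + g p (X p) (D Y U p) = 0"
proof -
  have "P p (U p) = 0" using U by (simp add: in_V)
  from \<beta>_identity[OF W this]
  have "dir_deriv \<A> U (\<lambda>q. g q (X q) (Y q)) p + g p (lie_bracket \<A> X U p) (Y p)
      + g p (X p) (lie_bracket \<A> Y U p) = 0"
    by (simp add: g_H(2)[OF X] g_H(1)[OF Y] \<beta>_V[OF U] dir_deriv_const[OF sm(1)])
  then show ?thesis
    using D_metric[OF W(1,2,5,3,4)] torsion[OF W(1,2,3,5)] torsion[OF W(1,2,4,5)]
    by (simp add: g_simps)
qed

text \<open>Skew-symmetry of \<open>A\<^sub>XY\<close>.  Now \<open>U\<close> extends a vertical vector arbitrarily, so the right-hand side of
  the pullback identity stays, with \<open>g\<close> in place of \<open>\<beta>\<close>.  Expanding every term by means of the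
  connection, all derivatives of \<open>U\<close> cancel.\<close>

lemma nabla_horizontal_skew:
  assumes W: "open W" "p \<in> W" "vf W X" "vf W Y" "vf W U"
    and X: "\<And>q. X q \<in> H q" and Y: "\<And>q. Y q \<in> H q" and U: "U p \<in> V p"
  shows "g p (D X Y p) (U p) + g p (D Y X p) (U p) = 0"
proof -
  have "P p (U p) = 0" using U by (simp add: in_V)
  from \<beta>_identity[OF W this]
  have "dir_deriv \<A> U (\<lambda>q. g q (X q) (Y q)) p + g p (lie_bracket \<A> X U p) (Y p)
      + g p (X p) (lie_bracket \<A> Y U p) =
      dir_deriv \<A> X (\<lambda>q. g q (U q) (Y q)) p + dir_deriv \<A> Y (\<lambda>q. g q (X q) (U q)) p"
    by (simp add: g_H(2)[OF X] g_H(1)[OF Y])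
  then show ?thesis
    using D_metric[OF W(1,2,5,3,4)] D_metric[OF W(1,2,3,5,4)] D_metric[OF W(1,2,4,3,5)]
      torsion[OF W(1,2,3,5)] torsion[OF W(1,2,4,5)] g_commute[of p "U p" "D X Y p"]
    by (simp add: g_simps)
qed

text \<open>The pullback identity for \<open>\<beta>J\<close> cancels the terms of \<open>d\<Phi>(X, Y, U)\<close> that differentiate along \<open>U\<close> or
  contain a bracket with \<open>U\<close>.  What remains, \<open>X(g(Y, \<phi>U)) - g([X, Y], \<phi>U)\<close>, is computed with the
  connection; the two resulting terms are equal by \<open>nabla_vertical_skew\<close> for the vertical field
  \<open>\<phi>U\<close>.\<close>

lemma d\<Phi>_horizontal_vertical:
  assumes W: "open W" "p \<in> W" "vf W X" "vf W Y" "vf W U"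
    and X: "\<And>q. X q \<in> H q" and U: "\<And>q. U q \<in> V q" and Y: "Y p \<in> H p"
  shows "ext_deriv2 \<A> \<Phi> X Y U p = 2 * g p (D X (\<lambda>q. \<phi> q (U q)) p) (Y p)"
proof -
  let ?\<phi>U = "\<lambda>q. \<phi> q (U q)"
  have \<phi>U: "vf W ?\<phi>U" "\<And>q. ?\<phi>U q \<in> V q" using vf_\<phi> W U \<phi>_V by auto
  have "P p (U p) = 0" using U by (simp add: in_V)
  from \<beta>J_identity[OF W this]
  have id: "dir_deriv \<A> U (\<lambda>q. \<Phi> q (X q) (Y q)) p + \<Phi> p (lie_bracket \<A> X U p) (Y p)
      + \<Phi> p (X p) (lie_bracket \<A> Y U p) = 0"
    by (simp add: \<Phi>_H(2)[OF X] \<Phi>_H(1)[OF Y] \<beta>J_V[OF U] dir_deriv_const[OF sm(1)])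
  have "ext_deriv2 \<A> \<Phi> X Y U p =
      dir_deriv \<A> X (\<lambda>q. g q (Y q) (?\<phi>U q)) p - g p (lie_bracket \<A> X Y p) (?\<phi>U p)"
    using id \<Phi>_skew[of p "X p" "lie_bracket \<A> Y U p"]
    by (simp add: ext_deriv2_def \<Phi>_H_V[OF X U] dir_deriv_const[OF sm(1)]) (simp add: fund_form_def)
  also have "\<dots> = g p (Y p) (D X ?\<phi>U p) + g p (D Y X p) (?\<phi>U p)"
    using D_metric[OF W(1,2,3,4) \<phi>U(1)] torsion[OF W(1,2,3,4)] by (simp add: g_simps)
  also have "g p (D Y X p) (?\<phi>U p) = - g p (X p) (D Y ?\<phi>U p)"
    using D_metric[OF W(1,2,4,3) \<phi>U(1)] g_H_V(1)[OF X \<phi>U(2)] by (simp add: dir_deriv_const[OF sm(1)])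
  finally show ?thesis
    using nabla_vertical_skew[OF W(1-4) \<phi>U(1) X \<phi>U(2) Y] by (simp add: g_commute)
qed

text \<open>Here the pullback identity leaves just \<open>-\<Phi>([X, Y], U)\<close>, and \<open>[X, Y]\<close> has the same vertical part as
  \<open>2 \<nabla>\<^sub>XY\<close>.\<close>

lemma d\<Phi>_horizontal_horizontal:
  assumes W: "open W" "p \<in> W" "vf W X" "vf W Y" "vf W U"
    and X: "\<And>q. X q \<in> H q" and Y: "\<And>q. Y q \<in> H q" and U: "U p \<in> V p"
  shows "ext_deriv2 \<A> \<Phi> X Y U p = - 2 * g p (D X Y p) (\<phi> p (U p))"
proof -
  let ?\<phi>U = "\<lambda>q. \<phi> q (U q)"
  have "P p (U p) = 0" using U by (simp add: in_V)
  from \<beta>J_identity[OF W this]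
  have "dir_deriv \<A> U (\<lambda>q. \<Phi> q (X q) (Y q)) p + \<Phi> p (lie_bracket \<A> X U p) (Y p)
      + \<Phi> p (X p) (lie_bracket \<A> Y U p) =
      dir_deriv \<A> X (\<lambda>q. \<Phi> q (U q) (Y q)) p + dir_deriv \<A> Y (\<lambda>q. \<Phi> q (X q) (U q)) p"
    by (simp add: \<Phi>_H(2)[OF X] \<Phi>_H(1)[OF Y])
  moreover have "dir_deriv \<A> X (\<lambda>q. \<Phi> q (Y q) (U q)) p = - dir_deriv \<A> X (\<lambda>q. \<Phi> q (U q) (Y q)) p"
  proof -
    have s: "smooth_fun \<A> W (\<lambda>q. \<Phi> q (Y q) (U q))" "smooth_fun \<A> W (\<lambda>q. \<Phi> q (U q) (Y q))"
      using metric W(1,4,5) vf_\<phi> by (auto simp: riemannian_metric_def fund_form_def)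
    have "dir_deriv \<A> X (\<lambda>q. \<Phi> q (Y q) (U q) + \<Phi> q (U q) (Y q)) p = 0"
      using \<Phi>_skew[of _ "Y _" "U _"] by (simp add: dir_deriv_const[OF sm(1)])
    then show ?thesis using dir_deriv_add[OF sm(1) s W(2)] by simp
  qed
  ultimately have "ext_deriv2 \<A> \<Phi> X Y U p = - g p (lie_bracket \<A> X Y p) (?\<phi>U p)"
    using \<Phi>_skew[of p "X p" "lie_bracket \<A> Y U p"]
    by (simp add: ext_deriv2_def) (simp add: fund_form_def)
  also have "\<dots> = - 2 * g p (D X Y p) (?\<phi>U p)"
    using torsion[OF W(1,2,3,4)] nabla_horizontal_skew[OF W(1-4) vf_\<phi>[OF W(1,5)] X Y \<phi>_V[OF U]]
    by (simp add: g_simps)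
  finally show ?thesis .
qed

text \<open>As \<open>\<Phi>\<close> annihilates \<open>\<xi>\<close>, all that is left of \<open>d\<Phi>(X, Y, \<xi>)\<close> is the Lie derivative of \<open>\<Phi>\<close> along
  \<open>\<xi>\<close>.  It agrees with that of \<open>\<beta>J\<close>, where the pullback identity applies: the difference
  \<open>\<Phi>(X, Y) - \<beta>J(X, Y)\<close> is \<open>(g - \<beta>)(X, \<phi>Y)\<close>, whose derivative vanishes at horizontal pairs.\<close>

lemma d\<Phi>_\<xi>:
  assumes W: "open W" "p \<in> W" "vf W X" "vf W Y" and XY: "X p \<in> H p" "Y p \<in> H p"
  shows "ext_deriv2 \<A> \<Phi> X Y \<xi> p = 0"
proof -
  have "P p (\<xi> p) = 0" using \<xi>_V by (simp add: in_V)
  from \<beta>J_identity[OF W vf_\<xi> this]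
  have "dir_deriv \<A> \<xi> (\<lambda>q. \<beta>J q (X q) (Y q)) p + \<beta>J p (lie_bracket \<A> X \<xi> p) (Y p)
      + \<beta>J p (X p) (lie_bracket \<A> Y \<xi> p) = 0"
    by (simp add: \<beta>J_V[OF \<xi>_V] dir_deriv_const[OF sm(1)])
  moreover have "dir_deriv \<A> \<xi> (\<lambda>q. \<Phi> q (X q) (Y q)) p = dir_deriv \<A> \<xi> (\<lambda>q. \<beta>J q (X q) (Y q)) p"
    using dir_deriv_g_horizontal[OF W(1-3) vf_\<phi>[OF W(1,4)] XY(1) \<phi>_H[OF XY(2)]]
    by (simp add: fund_form_def \<beta>J_eq)
  ultimately show ?thesis
    using \<Phi>_skew[of p "X p" "lie_bracket \<A> Y \<xi> p"]
    by (simp add: ext_deriv2_def \<Phi>_\<xi> dir_deriv_const[OF sm(1)] \<Phi>_H XY)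
qed

lemma oneill_horizontal:
  assumes "horizontal_field \<A> \<A>' g \<pi> X" "horizontal_field \<A> \<A>' g \<pi> Y"
  shows "oneill_A \<A> \<A>' g D \<pi> X Y p = vp p (D X Y p)"
  using assms D_zero[of UNIV p X]
  by (simp add: oneill_A_def horizontal_field_def hp_eq vp_H vp_0)

lemma oneill_vertical:
  assumes "horizontal_field \<A> \<A>' g \<pi> X" "vertical_field \<A> \<A>' \<pi> U"
  shows "oneill_A \<A> \<A>' g D \<pi> X U p = hp p (D X U p)"
  using assms D_zero[of UNIV p X]
  by (simp add: oneill_A_def horizontal_field_def vertical_field_def hp_eq vp_H vp_V vp_0)

end

section \<open>The Lee form\<close>

locale lee_submersion = contact_submersion +
  fixes m :: nat and \<omega> B
  assumes m: "m \<ge> 2"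
    and lee: "\<omega> = lee_form m \<A> \<phi> \<xi> \<eta> g D"
    and lee_vector: "metric_dual \<A> g \<omega> B"
    and d\<Phi>: "\<And>W X Y Z p. open W \<Longrightarrow> vector_field \<A> W X \<Longrightarrow> vector_field \<A> W Y \<Longrightarrow>
       vector_field \<A> W Z \<Longrightarrow> p \<in> W \<Longrightarrow>
       ext_deriv2 \<A> \<Phi> X Y Z p = - 2 * wedge12 \<omega> \<Phi> X Y Z p"
begin

lemma \<omega>_eq: "open W \<Longrightarrow> p \<in> W \<Longrightarrow> vf W X \<Longrightarrow> \<omega> X p = g p (B p) (X p)"
  using lee_vector by (auto simp: metric_dual_def)

lemma horizontal_nonzero: "\<exists>x\<in>H p. x \<noteq> 0"
proof -
  obtain b :: 'd where b: "b \<in> Basis" using nonempty_Basis by blast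
  obtain u where u: "P p u = b" using surj_P by (metis surj_def)
  have "P p (hp p u) = b" using hp(2)[of u p] u by (simp add: in_V P_simps)
  then have "hp p u \<noteq> 0" using b by (auto simp: P_simps)
  then show ?thesis using hp(1) by blast
qed

text \<open>For \<open>x\<close> horizontal, \<open>d\<Phi>(x, \<phi>x, \<xi>) = 0\<close>, while \<open>(\<omega> \<and> \<Phi>)(x, \<phi>x, \<xi>) = - \<omega>(\<xi>) g(x, x)\<close>.\<close>

lemma \<omega>_\<xi>: "\<omega> \<xi> p = 0"
proof -
  obtain x where x: "x \<in> H p" "x \<noteq> 0" using horizontal_nonzero by blast
  obtain W X where W: "open W" "p \<in> W" "vf W X" "X p = x" using vf_through by blast
  let ?Y = "\<lambda>q. \<phi> q (X q)"
  have Y: "vf W ?Y" using vf_\<phi> W by blast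
  have "wedge12 \<omega> \<Phi> X ?Y \<xi> p = 0"
    using d\<Phi>[OF W(1,3) Y vf_\<xi> W(2)] d\<Phi>_\<xi>[OF W(1-3) Y] x W(4) by (simp add: \<phi>_H)
  moreover have "\<Phi> p x (\<phi> p x) = - g p x x"
    by (simp add: fund_form_def \<phi>\<phi> \<eta>_H[OF x(1)] g_simps)
  ultimately have "\<omega> \<xi> p * g p x x = 0" by (simp add: wedge12_def \<Phi>_\<xi> W(4))
  then show ?thesis using g_pos[OF x(2), of p] by simp
qed

lemma lee_of_kernel:
  assumes "\<And>q. \<phi> q (X q) = 0" "cov_deriv1 \<A> D \<eta> \<xi> X p = 0"
  shows "\<omega> X p = - 1 / (2 * (real m - 1)) * codiff2 \<A> g D \<Phi> (\<lambda>q. 0) p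
    + codiff1 \<A> g D \<eta> p / (2 * real m) * \<eta> p (X p)"
  using assms by (simp add: lee lee_form_def)

text \<open>The Lee form has the metric dual \<open>B\<close>, so it vanishes on the zero field, which forces
  \<open>\<delta>\<Phi>(0) = 0\<close> for the frame that defines the codifferential.  As \<open>\<phi>\<xi> = 0\<close>, it follows that
  \<open>\<omega>(\<xi>) = \<delta>\<eta>/2m\<close>.\<close>

lemma codiff_\<eta>: "codiff1 \<A> g D \<eta> p = 0"
proof -
  have UN: "open (UNIV :: 'a set)" "p \<in> UNIV" by auto
  have "cov_deriv1 \<A> D \<eta> \<xi> (\<lambda>q. 0) p = 0"
    using D_zero[OF UN vf_\<xi>] by (simp add: cov_deriv1_def \<eta>_simps dir_deriv_const[OF sm(1)])
  from lee_of_kernel[OF _ this] have 0: "codiff2 \<A> g D \<Phi> (\<lambda>q. 0) p = 0"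
    using \<omega>_eq[OF UN vf_0] m by (simp add: \<phi>_simps \<eta>_simps g_simps)
  have "g p (D \<xi> \<xi> p) (\<xi> p) = 0"
    using D_metric[OF UN vf_\<xi> vf_\<xi> vf_\<xi>] g_commute[of p "\<xi> p"]
    by (simp add: \<eta>_eq[symmetric] \<eta>_\<xi> dir_deriv_const[OF sm(1)])
  then have "cov_deriv1 \<A> D \<eta> \<xi> \<xi> p = 0"
    by (simp add: cov_deriv1_def \<eta>_\<xi> dir_deriv_const[OF sm(1)] \<eta>_eq[of p "D \<xi> \<xi> p"])
  from lee_of_kernel[OF \<phi>_\<xi> this] show ?thesis
    using m by (simp add: 0 \<omega>_\<xi> \<eta>_\<xi>)
qed

text \<open>Testing against a horizontal vector \<open>y\<close>: the two expressions for \<open>d\<Phi>(X, Y, \<phi>U)\<close> determine the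
  horizontal part of \<open>\<nabla>\<^sub>X(\<phi>\<phi>U)\<close>, and \<open>\<phi>\<phi>U + U = \<eta>(U) \<xi>\<close> carries it over to \<open>\<nabla>\<^sub>XU\<close>; the derivative
  of \<open>\<eta>(U)\<close> multiplies the vertical vector \<open>\<xi>\<close> and drops out.\<close>

lemma nabla_vertical:
  assumes X: "vf UNIV X" "\<And>q. X q \<in> H q" and U: "vf UNIV U" "\<And>q. U q \<in> V q"
  shows "hp p (D X U p) = \<eta> p (U p) *\<^sub>R hp p (D X \<xi> p) - \<omega> (\<lambda>q. \<phi> q (U q)) p *\<^sub>R \<phi> p (X p)"
    (is "_ = ?r")
proof (rule H_eqI)
  show "hp p (D X U p) \<in> H p" "?r \<in> H p" using hp(1) H_combine \<phi>_H X by auto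
  let ?\<phi>U = "\<lambda>q. \<phi> q (U q)"
  let ?\<phi>\<phi>U = "\<lambda>q. \<phi> q (?\<phi>U q)"
  fix y assume y: "y \<in> H p"
  obtain W Y where W: "open W" "p \<in> W" "vf W Y" "Y p = y" using vf_through by blast
  have f: "vf W X" "vf W U" "vf W ?\<phi>U" "vf W ?\<phi>\<phi>U" using vf_UNIV X U vf_\<phi> W(1) by auto
  have \<phi>U: "?\<phi>U q \<in> V q" for q using U \<phi>_V by blast
  have "ext_deriv2 \<A> \<Phi> X Y ?\<phi>U p = - 2 * (\<omega> ?\<phi>U p * \<Phi> p (X p) y)"
    using d\<Phi>[OF W(1) f(1) W(3) f(3) W(2)] X \<phi>U y
    by (simp add: wedge12_def W(4) \<Phi>_H_V)
  then have 1: "g p (D X ?\<phi>\<phi>U p) y = - \<omega> ?\<phi>U p * \<Phi> p (X p) y"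
    using d\<Phi>_horizontal_vertical[OF W(1,2) f(1) W(3) f(3) X(2) \<phi>U y[folded W(4)], unfolded W(4)]
    by linarith
  have "D X (\<lambda>q. ?\<phi>\<phi>U q + U q) p = D X (\<lambda>q. \<eta> q (U q) *\<^sub>R \<xi> q) p" by (simp add: \<phi>\<phi>)
  then have "D X ?\<phi>\<phi>U p + D X U p =
      dir_deriv \<A> X (\<lambda>q. \<eta> q (U q)) p *\<^sub>R \<xi> p + \<eta> p (U p) *\<^sub>R D X \<xi> p"
    using D_add[OF W(1,2) f(1) f(4) f(2)] D_scale[OF W(1,2) f(1) vf_\<xi> smooth_\<eta>[OF W(1) f(2)]] by simp
  then have "g p (D X ?\<phi>\<phi>U p + D X U p) y = \<eta> p (U p) * g p (D X \<xi> p) y"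
    using g_H_V(2)[OF y \<xi>_V] by (simp add: g_simps)
  then have "g p (D X U p) y = \<eta> p (U p) * g p (D X \<xi> p) y + \<omega> ?\<phi>U p * \<Phi> p (X p) y"
    using 1 by (simp add: g_simps)
  then show "g p (hp p (D X U p)) y = g p ?r y"
    using g_\<phi>_skew[of p "X p" y] by (simp add: g_hp[OF y] g_simps fund_form_def)
qed

text \<open>Testing against a vertical vector \<open>w\<close>: the hypothesis on \<open>d\<Phi>\<close> is evaluated on an extension of
  \<open>\<phi>w\<close>, so that \<open>\<phi>\<phi>w = -w + \<eta>(w) \<xi>\<close> brings back \<open>w\<close> itself.\<close>

lemma nabla_horizontal:
  assumes X: "vf UNIV X" "\<And>q. X q \<in> H q" and Y: "vf UNIV Y" "\<And>q. Y q \<in> H q"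
  shows "vp p (D X Y p) = \<eta> p (vp p (D X Y p)) *\<^sub>R \<xi> p + \<Phi> p (X p) (Y p) *\<^sub>R vp p (\<phi> p (B p))"
    (is "_ = ?r")
proof (rule V_eqI)
  show "vp p (D X Y p) \<in> V p" "?r \<in> V p" using vp(1) V_combine \<xi>_V by auto
  fix w assume w: "w \<in> V p"
  obtain W U where W: "open W" "p \<in> W" "vf W U" "U p = \<phi> p w" using vf_through by blast
  have f: "vf W X" "vf W Y" using vf_UNIV X Y by auto
  have Up: "U p \<in> V p" using w \<phi>_V W(4) by simp
  have "ext_deriv2 \<A> \<Phi> X Y U p = - 2 * (g p (B p) (\<phi> p w) * \<Phi> p (X p) (Y p))"
    using d\<Phi>[OF W(1) f W(3,2)] \<omega>_eq[OF W(1-3)] X Y Up by (simp add: wedge12_def \<Phi>_H_V W(4))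
  then have "g p (D X Y p) (\<phi> p (\<phi> p w)) = g p (B p) (\<phi> p w) * \<Phi> p (X p) (Y p)"
    using d\<Phi>_horizontal_horizontal[OF W(1,2) f W(3) X(2) Y(2) Up] by (simp add: W(4))
  then have "g p (D X Y p) w = \<eta> p (D X Y p) * \<eta> p w + \<Phi> p (X p) (Y p) * g p (\<phi> p (B p)) w"
    by (simp add: g_\<phi>_skew \<phi>\<phi> g_simps \<eta>_eq mult.commute)
  then show "g p (vp p (D X Y p)) w = g p ?r w"
    by (simp add: g_simps g_vp[OF w] \<eta>_eq g_vp[OF \<xi>_V] g_commute[of p "\<xi> p" w])
qed

lemma oneill_invariant:
  assumes X: "horizontal_field \<A> \<A>' g \<pi> X" and Y: "horizontal_field \<A> \<A>' g \<pi> Y"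
    and U: "vertical_field \<A> \<A>' \<pi> U"
  defines "A \<equiv> oneill_A \<A> \<A>' g D \<pi>"
    and "\<phi>X \<equiv> \<lambda>q. \<phi> q (X q)" and "\<phi>Y \<equiv> \<lambda>q. \<phi> q (Y q)" and "\<phi>U \<equiv> \<lambda>q. \<phi> q (U q)"
  shows "A X U p = \<eta> p (U p) *\<^sub>R A X \<xi> p - \<omega> \<phi>U p *\<^sub>R \<phi> p (X p)"
    and "A X Y p = \<eta> p (A X Y p) *\<^sub>R \<xi> p + \<Phi> p (X p) (Y p) *\<^sub>R vp p (\<phi> p (B p))"
    and "A \<phi>X U p - \<phi> p (A X U p) = \<eta> p (U p) *\<^sub>R (A \<phi>X \<xi> p - \<phi> p (A X \<xi> p))"
    and "A X Y p - A \<phi>X \<phi>Y p = \<eta> p (A X Y p - A \<phi>X \<phi>Y p) *\<^sub>R \<xi> p"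
proof -
  have \<phi>_field: "horizontal_field \<A> \<A>' g \<pi> (\<lambda>q. \<phi> q (Z q))"
    if "horizontal_field \<A> \<A>' g \<pi> Z" for Z
    using that vf_\<phi>[of UNIV Z] \<phi>_H by (simp add: horizontal_field_def)
  note \<phi>X = \<phi>_field[OF X, folded \<phi>X_def] and \<phi>Y = \<phi>_field[OF Y, folded \<phi>Y_def]
  have \<xi>: "vertical_field \<A> \<A>' \<pi> \<xi>" using \<xi>_field \<xi>_V by (simp add: vertical_field_def)
  have AU: "A Z U p = \<eta> p (U p) *\<^sub>R A Z \<xi> p - \<omega> \<phi>U p *\<^sub>R \<phi> p (Z p)"
    if "horizontal_field \<A> \<A>' g \<pi> Z" for Z
    using nabla_vertical[of Z U p] oneill_vertical[OF that U] oneill_vertical[OF that \<xi>] that U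
    by (simp add: A_def \<phi>U_def horizontal_field_def vertical_field_def)
  have AY: "A Z Z' p = \<eta> p (A Z Z' p) *\<^sub>R \<xi> p + \<Phi> p (Z p) (Z' p) *\<^sub>R vp p (\<phi> p (B p))"
    if "horizontal_field \<A> \<A>' g \<pi> Z" "horizontal_field \<A> \<A>' g \<pi> Z'" for Z Z'
    unfolding A_def oneill_horizontal[OF that]
    by (rule nabla_horizontal) (use that in \<open>auto simp: horizontal_field_def\<close>)
  show "A X U p = \<eta> p (U p) *\<^sub>R A X \<xi> p - \<omega> \<phi>U p *\<^sub>R \<phi> p (X p)" using AU[OF X] .
  show "A X Y p = \<eta> p (A X Y p) *\<^sub>R \<xi> p + \<Phi> p (X p) (Y p) *\<^sub>R vp p (\<phi> p (B p))"
    using AY[OF X Y] .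
  show "A \<phi>X U p - \<phi> p (A X U p) = \<eta> p (U p) *\<^sub>R (A \<phi>X \<xi> p - \<phi> p (A X \<xi> p))"
    unfolding AU[OF X] AU[OF \<phi>X] by (simp add: \<phi>X_def \<phi>_simps algebra_simps)
  have "\<Phi> p (\<phi>X p) (\<phi>Y p) = \<Phi> p (X p) (Y p)" by (simp add: \<phi>X_def \<phi>Y_def \<Phi>_\<phi>\<phi>)
  then have "A X Y p - A \<phi>X \<phi>Y p = (\<eta> p (A X Y p) - \<eta> p (A \<phi>X \<phi>Y p)) *\<^sub>R \<xi> p"
    using AY[OF X Y] AY[OF \<phi>X \<phi>Y] by (metis add_diff_cancel_right scaleR_left_diff_distrib)
  then show "A X Y p - A \<phi>X \<phi>Y p = \<eta> p (A X Y p - A \<phi>X \<phi>Y p) *\<^sub>R \<xi> p"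
    unfolding linear_diff[OF linear_\<eta>] .
qed

end

theorem proposition2p1:
  fixes \<A> :: "('a::{t2_space, second_countable_topology}, 'e::euclidean_space) chart set"
    and \<phi> :: "'a \<Rightarrow> 'e \<Rightarrow> 'e" and \<xi> :: "'a \<Rightarrow> 'e" and \<eta> :: "'a \<Rightarrow> 'e \<Rightarrow> real"
    and g :: "'a \<Rightarrow> 'e \<Rightarrow> 'e \<Rightarrow> real"
    and \<A>' :: "('b::{t2_space, second_countable_topology}, 'f::euclidean_space) chart set"
    and J :: "'b \<Rightarrow> 'f \<Rightarrow> 'f" and g' :: "'b \<Rightarrow> 'f \<Rightarrow> 'f \<Rightarrow> real"
    and \<pi> :: "'a \<Rightarrow> 'b"
    and D :: "('a \<Rightarrow> 'e) \<Rightarrow> ('a \<Rightarrow> 'e) \<Rightarrow> 'a \<Rightarrow> 'e"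
    and \<omega> :: "('a \<Rightarrow> 'e) \<Rightarrow> 'a \<Rightarrow> real" and B :: "'a \<Rightarrow> 'e"
    and \<Phi> :: "'a \<Rightarrow> 'e \<Rightarrow> 'e \<Rightarrow> real"
    and A :: "('a \<Rightarrow> 'e) \<Rightarrow> ('a \<Rightarrow> 'e) \<Rightarrow> 'a \<Rightarrow> 'e"
    and m n :: nat
  assumes subm: "contact_complex_submersion \<A> \<phi> \<xi> \<eta> g \<A>' J g' \<pi>"
    and dimM: "DIM('e) = 2 * m + 1" "2 * m + 1 \<ge> 5"
    and dimM': "DIM('f) = 2 * n" "2 * n \<ge> 2"
    and LC: "levi_civita \<A> g D"
    and Phi: "\<Phi> = fund_form g \<phi>"
    and lee: "\<omega> = lee_form m \<A> \<phi> \<xi> \<eta> g D"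
    and lee_vector: "metric_dual \<A> g \<omega> B"
    and oneill: "A = oneill_A \<A> \<A>' g D \<pi>"
    and dPhi: "\<And>W X Y Z p. open W \<Longrightarrow> vector_field \<A> W X \<Longrightarrow> vector_field \<A> W Y \<Longrightarrow>
       vector_field \<A> W Z \<Longrightarrow> p \<in> W \<Longrightarrow>
       ext_deriv2 \<A> \<Phi> X Y Z p = - 2 * wedge12 \<omega> \<Phi> X Y Z p"
  shows "(\<forall>p. codiff1 \<A> g D \<eta> p = 0) \<and>
    (\<forall>X Y U p. horizontal_field \<A> \<A>' g \<pi> X \<and> horizontal_field \<A> \<A>' g \<pi> Y \<and>
       vertical_field \<A> \<A>' \<pi> U \<longrightarrow>
       (let \<phi>X = (\<lambda>q. \<phi> q (X q)); \<phi>Y = (\<lambda>q. \<phi> q (Y q)); \<phi>U = (\<lambda>q. \<phi> q (U q)) in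
         A X U p = \<eta> p (U p) *\<^sub>R A X \<xi> p - \<omega> \<phi>U p *\<^sub>R \<phi> p (X p) \<and>
         A X Y p = \<eta> p (A X Y p) *\<^sub>R \<xi> p + \<Phi> p (X p) (Y p) *\<^sub>R vproj \<A> \<A>' g \<pi> p (\<phi> p (B p)) \<and>
         A \<phi>X U p - \<phi> p (A X U p) = \<eta> p (U p) *\<^sub>R (A \<phi>X \<xi> p - \<phi> p (A X \<xi> p)) \<and>
         A X Y p - A \<phi>X \<phi>Y p = \<eta> p (A X Y p - A \<phi>X \<phi>Y p) *\<^sub>R \<xi> p))"
proof -
  interpret lee_submersion \<A> \<phi> \<xi> \<eta> g \<A>' J g' \<pi> D m \<omega> B
    by unfold_locales (use subm LC dimM lee lee_vector dPhi Phi in auto)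
  show ?thesis
    unfolding Let_def Phi oneill using codiff_\<eta> oneill_invariant by blast
qed

end
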